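(* Let $\mathcal{D}$ be a dyadic lattice in $\mathbb{R}^d$ and let $\mathbb{S}$ be an elementary (possibly generalized) dyadic shift of complexity $r$ in $\mathbb{R}^d$ with respect to $\mathcal{D}$, such that all restricted shifts $\mathbb{S}_{\mathcal{A}}$ are uniformly bounded in $L^2$: \[ \sup_{\mathcal{A}\subset\mathcal{D}}\|\mathbb{S}_{\mathcal{A}}\|_{L^2\to L^2}=:B_2<\infty. \] Then for any $A_2$ weight $w$ \[ \|\mathbb{S}f\|_{L^2(w)}\le C\,2^{3d/2}(r+1)^2\,(B_2^2+1)\,[w]_{A_2}\,\|f\|_{L^2(w)}\qquad\forall f\in L^2(w), \] where $C$ is an absolute constant.
   Context: Dyadic lattices: $\mathcal{D}^0=\bigcup_k\{2^k([0,1)^d+m):m\in\mathbb{Z}^d\}$; for $\omega\in(\{0,1\}^d)^{\mathbb{Z}}$ and $I\in\mathcal{D}^0$ with $\ell(I)=2^k$ put $I\dot+\omega=I+\sum_{j<k}\omega_j2^j$; a dyadic lattice is $\mathcal{D}=\{I\dot+\omega:I\in\mathcal{D}^0\}$ for some $\omega$. $\ell(Q)$ denotes side length. A generalized Haar function for $Q\in\mathcal{D}$ is a function supported on $Q$ and constant on each of the $2^d$ dyadic children of $Q$; a Haar function additionally has integral zero. An elementary dyadic shift with parameters $m,n\in\{0,1,2,\dots\}$ is \[ \mathbb{S}f(x)=\sum_{Q\in\mathcal{D}}\int_Q a_Q(x,y)f(y)\,dy,\qquad a_Q(x,y)=|Q|^{-1}\sum_{\substack{Q',Q''\in\mathcal{D},\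 Q',Q''\subset Q\\ \ell(Q')=2^{-m}\ell(Q),\ \ell(Q'')=2^{-n}\ell(Q)}}h_{Q''}^{Q'}(x)\,h_{Q'}^{Q''}(y), \] where $h_{Q'}^{Q''},h_{Q''}^{Q'}$ are Haar functions for $Q',Q''$ respectively with $\|h_{Q'}^{Q''}\|_\infty\|h_{Q''}^{Q'}\|_\infty\le1$ (so $a_Q$ is supported on $Q\times Q$ and $\|a_Q\|_\infty\le|Q|^{-1}$). If generalized Haar functions are allowed, it is an elementary generalized dyadic shift. The complexity is $r=\max(m,n)$. Standing assumption: shifts are finite, i.e. only finitely many $a_Q$ are nonzero, with all estimates independent of this number. For $\mathcal{A}\subset\mathcal{D}$ the restricted shift $\mathbb{S}_{\mathcal{A}}$ is obtained by summing only over $Q\in\mathcal{A}$. A weight $w$ is an a.e. positive locally integrable function with $w^{-1}$ locally integrable; it is $A_2$ if $[w]_{A_2}=\sup_Q\big(|Q|^{-1}\int_Qw\big)\big(|Q|^{-1}\int_Qw^{-1}\big)<\infty$ (supremum over all cubes). $\|f\|^2_{L^2(w)}=\int|f|^2w\,dx$. *)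

theory Defs
  imports "HOL-Analysis.Analysis"
begin

text \<open>
  The constant of the theorem must not depend on the dimension \<open>d\<close>, so \<open>d\<close> is a natural number
  quantified inside the formula and \<open>\<real>\<^sup>d\<close> is the set of extensional functions on \<open>{..<d}\<close>, i.e.
  the space of the product measure. The completion makes measurability Lebesgue measurability.
\<close>

type_synonym point = "nat \<Rightarrow> real"

definition Leb :: "nat \<Rightarrow> point measure" where
  "Leb d = completion (Pi\<^sub>M {..<d} (\<lambda>_. lborel))"

abbreviation Rd :: "nat \<Rightarrow> point set" where
  "Rd d \<equiv> {..<d} \<rightarrow>\<^sub>E UNIV"

lemma space_Leb: "space (Leb d) = Rd d"
  by (simp add: Leb_def space_PiM)

definition cube :: "nat \<Rightarrow> point \<Rightarrow> real \<Rightarrow> point set" where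
  "cube d c s = (\<Pi>\<^sub>E i\<in>{..<d}. {c i..<c i + s})"

definition side_length :: "nat \<Rightarrow> point set \<Rightarrow> real" where
  "side_length d Q = (THE s. 0 < s \<and> (\<exists>c. Q = cube d c s))"

lemma side_length_cube:
  assumes "1 \<le> d" "0 < s"
  shows "side_length d (cube d c s) = s"
proof -
  have *: "t = s" if "0 < t" and eq: "cube d c s = cube d b t" for t b
  proof -
    have ne: "cube d c s \<noteq> {}"
      using assms by (auto simp: cube_def PiE_eq_empty_iff)
    have "(\<Pi>\<^sub>E i\<in>{..<d}. {c i..<c i + s}) = (\<Pi>\<^sub>E i\<in>{..<d}. {b i..<b i + t})"
      using eq by (simp add: cube_def)
    then have "\<forall>i\<in>{..<d}. {c i..<c i + s} = {b i..<b i + t}"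
      using assms that by (subst (asm) PiE_eq_iff_not_empty) auto
    then have "{c 0..<c 0 + s} = {b 0..<b 0 + t}"
      using assms by auto
    then have "c 0 = b 0 \<and> c 0 + s = b 0 + t"
      using assms that by (subst (asm) Ico_eq_Ico) auto
    then show ?thesis by simp
  qed
  show ?thesis
    unfolding side_length_def using assms * by (intro the_equality) blast+
qed

definition std_dyadic :: "nat \<Rightarrow> point set set" where
  "std_dyadic d =
     {cube d (\<lambda>i. 2 powi k * real_of_int (m i)) (2 powi k) | (k::int) (m :: nat \<Rightarrow> int). True}"

definition translate :: "nat \<Rightarrow> point \<Rightarrow> point set \<Rightarrow> point set" where
  "translate d t I = (\<lambda>x. \<lambda>i\<in>{..<d}. x i + t i) ` I"

definition dyadic_lattice :: "nat \<Rightarrow> point set set \<Rightarrow> bool" where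
  "dyadic_lattice d D \<longleftrightarrow>
     (\<exists>\<omega> :: int \<Rightarrow> nat \<Rightarrow> real. (\<forall>j i. \<omega> j i \<in> {0, 1}) \<and>
        D = {translate d (\<lambda>i. \<Sum>\<^sub>\<infinity>j\<in>{..<k}. \<omega> j i * 2 powi j) I | I k.
               I \<in> std_dyadic d \<and> side_length d I = 2 powi k})"

definition subcubes :: "nat \<Rightarrow> point set set \<Rightarrow> nat \<Rightarrow> point set \<Rightarrow> point set set" where
  "subcubes d D m Q =
     {R \<in> D. R \<subseteq> Q \<and> side_length d R = 2 powi (- int m) * side_length d Q}"

definition generalized_haar :: "nat \<Rightarrow> point set set \<Rightarrow> point set \<Rightarrow> (point \<Rightarrow> complex) \<Rightarrow> bool" where
  "generalized_haar d D Q h \<longleftrightarrow>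
     (\<forall>x\<in>Rd d - Q. h x = 0) \<and> (\<forall>R\<in>subcubes d D 1 Q. h constant_on R)"

definition haar :: "nat \<Rightarrow> point set set \<Rightarrow> point set \<Rightarrow> (point \<Rightarrow> complex) \<Rightarrow> bool" where
  "haar d D Q h \<longleftrightarrow> generalized_haar d D Q h \<and> (LINT x|Leb d. h x) = 0"

text \<open>
  Only applied to (generalized) Haar functions. These take finitely many values, each nonzero one
  on a set of positive measure, so this supremum is their \<open>L\<^sup>\<infinity>\<close> norm.
\<close>

definition sup_norm :: "nat \<Rightarrow> (point \<Rightarrow> complex) \<Rightarrow> real" where
  "sup_norm d h = (SUP x\<in>Rd d. norm (h x))"

text \<open>
  In the kernel, \<open>u Q' Q''\<close> is the function \<open>h\<close> with subscript \<open>Q''\<close> and superscript \<open>Q'\<close>, and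
  \<open>v Q' Q''\<close> the one with subscript \<open>Q'\<close> and superscript \<open>Q''\<close>. They are two separate families:
  for \<open>m = n\<close> a single family indexed by subscript and superscript would force the kernel to be
  symmetric. The parameter \<open>H\<close> is the class of functions allowed for a given cube.
\<close>

definition shift_kernel ::
  "(point set \<Rightarrow> (point \<Rightarrow> complex) \<Rightarrow> bool) \<Rightarrow> nat \<Rightarrow> point set set \<Rightarrow> nat \<Rightarrow> nat \<Rightarrow>
   (point set \<Rightarrow> point \<Rightarrow> point \<Rightarrow> complex) \<Rightarrow> bool" where
  "shift_kernel H d D m n a \<longleftrightarrow>
     (\<exists>u v :: point set \<Rightarrow> point set \<Rightarrow> point \<Rightarrow> complex.
        (\<forall>Q\<in>D. \<forall>Q'\<in>subcubes d D m Q. \<forall>Q''\<in>subcubes d D n Q.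
           H Q'' (u Q' Q'') \<and> H Q' (v Q' Q'') \<and>
           sup_norm d (v Q' Q'') * sup_norm d (u Q' Q'') \<le> 1) \<and>
        (\<forall>Q\<in>D. \<forall>x\<in>Rd d. \<forall>y\<in>Rd d.
           a Q x y = complex_of_real (1 / measure (Leb d) Q) *
             (\<Sum>Q'\<in>subcubes d D m Q. \<Sum>Q''\<in>subcubes d D n Q. u Q' Q'' x * v Q' Q'' y))) \<and>
     finite {Q \<in> D. \<exists>x\<in>Rd d. \<exists>y\<in>Rd d. a Q x y \<noteq> 0}"

definition elementary_shift ::
  "nat \<Rightarrow> point set set \<Rightarrow> nat \<Rightarrow> nat \<Rightarrow> (point set \<Rightarrow> point \<Rightarrow> point \<Rightarrow> complex) \<Rightarrow> bool" where
  "elementary_shift d D = shift_kernel (haar d D) d D"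

definition elementary_generalized_shift ::
  "nat \<Rightarrow> point set set \<Rightarrow> nat \<Rightarrow> nat \<Rightarrow> (point set \<Rightarrow> point \<Rightarrow> point \<Rightarrow> complex) \<Rightarrow> bool" where
  "elementary_generalized_shift d D = shift_kernel (generalized_haar d D) d D"

text \<open>The sum has only finitely many nonzero terms, by the finiteness clause in \<open>shift_kernel\<close>.\<close>

definition dyadic_shift ::
  "nat \<Rightarrow> (point set \<Rightarrow> point \<Rightarrow> point \<Rightarrow> complex) \<Rightarrow> point set set \<Rightarrow>
   (point \<Rightarrow> complex) \<Rightarrow> point \<Rightarrow> complex" where
  "dyadic_shift d a A f x = (\<Sum>\<^sub>\<infinity>Q\<in>A. LINT y:Q|Leb d. a Q x y * f y)"

definition L2 :: "nat \<Rightarrow> (point \<Rightarrow> real) \<Rightarrow> (point \<Rightarrow> complex) set" where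
  "L2 d w = {f \<in> borel_measurable (Leb d). integrable (Leb d) (\<lambda>x. (norm (f x))\<^sup>2 * w x)}"

definition L2_norm :: "nat \<Rightarrow> (point \<Rightarrow> real) \<Rightarrow> (point \<Rightarrow> complex) \<Rightarrow> real" where
  "L2_norm d w f = sqrt (LINT x|Leb d. (norm (f x))\<^sup>2 * w x)"

text \<open>Equal to \<open>\<infinity>\<close> (infimum of the empty set) if \<open>T\<close> is not bounded on the unweighted \<open>L\<^sup>2\<close>.\<close>

definition op_norm :: "nat \<Rightarrow> ((point \<Rightarrow> complex) \<Rightarrow> point \<Rightarrow> complex) \<Rightarrow> ereal" where
  "op_norm d T =
     (INF K\<in>{K. 0 \<le> K \<and> (\<forall>f\<in>L2 d (\<lambda>_. 1). T f \<in> L2 d (\<lambda>_. 1) \<and>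
                        L2_norm d (\<lambda>_. 1) (T f) \<le> K * L2_norm d (\<lambda>_. 1) f)}. ereal K)"

text \<open>
  Half-open cubes suffice below: boundaries are null sets, and every bounded set lies in a cube.
\<close>

definition locally_integrable :: "nat \<Rightarrow> (point \<Rightarrow> real) \<Rightarrow> bool" where
  "locally_integrable d f \<longleftrightarrow>
     f \<in> borel_measurable (Leb d) \<and> (\<forall>c s. set_integrable (Leb d) (cube d c s) f)"

definition weight :: "nat \<Rightarrow> (point \<Rightarrow> real) \<Rightarrow> bool" where
  "weight d w \<longleftrightarrow>
     (AE x in Leb d. 0 < w x) \<and> locally_integrable d w \<and>
     locally_integrable d (\<lambda>x. inverse (w x))"

definition A2_char :: "nat \<Rightarrow> (point \<Rightarrow> real) \<Rightarrow> ereal" where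
  "A2_char d w =
     (SUP (c, s)\<in>UNIV \<times> {0<..}.
        ereal ((1 / measure (Leb d) (cube d c s) * (LINT x:cube d c s|Leb d. w x)) *
               (1 / measure (Leb d) (cube d c s) * (LINT x:cube d c s|Leb d. inverse (w x)))))"

definition A2_weight :: "nat \<Rightarrow> (point \<Rightarrow> real) \<Rightarrow> bool" where
  "A2_weight d w \<longleftrightarrow> weight d w \<and> A2_char d w < \<infinity>"

end

theory Submission
  imports Defs
begin

text \<open>
  A finite shift only sees averages over the cubes of a sufficiently fine generation \<open>2\<^sup>N\<close>, so the
  estimate is one about functions on a finite tree of cells. Given a top cell \<open>X\<close> and \<open>f\<close>, \<open>g\<close> on
  it, stop at the maximal cells on which the average of \<open>\<bar>f\<bar>\<close> or of \<open>\<bar>g\<bar>\<close> exceeds four times its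
  average over \<open>X\<close>; they fill at most half of \<open>X\<close>. Replace \<open>f\<close> and \<open>g\<close> by their averages over the
  stopping cells. The averages are bounded by \<open>4 \<cdot> 2\<^sup>d\<close> times those over \<open>X\<close> and are handled by the
  unweighted bound \<open>B\<^sub>2\<close>. The mean zero parts pair nontrivially only with the \<open>r\<close> generations just
  above a stopping cell, because kernels of larger cubes are constant there. This bounds the part of
  the form above the stopping cells by a multiple of \<open>\<langle>\<bar>f\<bar>\<rangle>\<^sub>X \<langle>\<bar>g\<bar>\<rangle>\<^sub>X \<bar>X\<bar>\<close>, and hence, by the \<open>A\<^sub>2\<close>
  condition, by the integral over the unstopped half of \<open>X\<close> of the product of the dyadic maximal
  functions of \<open>f w\<close> and \<open>g / w\<close> with respect to the measures \<open>dx / w\<close> and \<open>w dx\<close>. Iterating in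
  the stopping cells, these halves stay disjoint, and Doob's \<open>L\<^sup>2\<close> inequality, whose constant does not
  depend on the dimension, finishes the proof by duality.
\<close>

section \<open>Forms on a tree of cells\<close>

definition class_map :: "'p set \<Rightarrow> ('p \<Rightarrow> 'p set) \<Rightarrow> bool" where
  "class_map X \<pi> \<longleftrightarrow> finite X \<and> (\<forall>p\<in>X. p \<in> \<pi> p \<and> \<pi> p \<subseteq> X \<and> (\<forall>q\<in>\<pi> p. \<pi> q = \<pi> p))"

lemma class_map_finite: "class_map X \<pi> \<Longrightarrow> p \<in> X \<Longrightarrow> finite (\<pi> p)"
  by (meson class_map_def finite_subset)

lemma class_map_card_pos: "class_map X \<pi> \<Longrightarrow> p \<in> X \<Longrightarrow> 0 < card (\<pi> p)"
  unfolding card_gt_0_iff by (metis class_map_def class_map_finite empty_iff)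

lemma class_map_eq: "class_map X \<pi> \<Longrightarrow> p \<in> X \<Longrightarrow> q \<in> \<pi> p \<Longrightarrow> \<pi> q = \<pi> p"
  unfolding class_map_def by blast

lemma sum_classes:
  assumes "class_map X \<pi>"
  shows "sum h X = (\<Sum>R\<in>\<pi> ` X. sum h R)"
proof -
  have "X = \<Union> (\<pi> ` X)"
    using assms unfolding class_map_def by blast
  moreover have "sum h (\<Union> (\<pi> ` X)) = (\<Sum>R\<in>\<pi> ` X. sum h R)"
  proof (rule sum.Union_disjoint[unfolded comp_def])
    show "\<forall>A\<in>\<pi> ` X. finite A"
      using class_map_finite[OF assms] by simp
    show "\<forall>A\<in>\<pi> ` X. \<forall>B\<in>\<pi> ` X. A \<noteq> B \<longrightarrow> A \<inter> B = {}"
      using class_map_eq[OF assms] by (metis (no_types, lifting) disjoint_iff imageE)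
  qed
  ultimately show ?thesis by simp
qed

text \<open>Double counting, since lying in a common class is a symmetric relation.\<close>

lemma sum_class_swap:
  assumes "class_map X \<pi>"
  shows "(\<Sum>p\<in>X. \<Sum>q\<in>\<pi> p. h p q) = (\<Sum>q\<in>X. \<Sum>p\<in>\<pi> q. h p q)"
proof -
  have fin: "finite X" using assms by (simp add: class_map_def)
  have 1: "{q. q \<in> X \<and> q \<in> \<pi> p} = \<pi> p" if "p \<in> X" for p
    using assms that unfolding class_map_def by blast
  have 2: "{p. p \<in> X \<and> q \<in> \<pi> p} = \<pi> q" if "q \<in> X" for q
    using assms that unfolding class_map_def by blast
  have "(\<Sum>p\<in>X. \<Sum>q\<in>{q. q \<in> X \<and> q \<in> \<pi> p}. h p q) = (\<Sum>q\<in>X. \<Sum>p\<in>{p. p \<in> X \<and> q \<in> \<pi> p}. h p q)"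
    by (rule sum.swap_restrict[OF fin fin])
  then show ?thesis using 1 2 by simp
qed

text \<open>Conditional expectation onto the partition, for counting measure. The value type is
  generic because it is applied to complex functions and to their real norms.\<close>

definition class_avg :: "('p \<Rightarrow> 'p set) \<Rightarrow> ('p \<Rightarrow> 'a::real_normed_field) \<Rightarrow> 'p \<Rightarrow> 'a" where
  "class_avg \<pi> h p = sum h (\<pi> p) / of_nat (card (\<pi> p))"

lemma norm_class_avg_le: "norm (class_avg \<pi> h p) \<le> class_avg \<pi> (\<lambda>q. norm (h q)) p"
  by (simp add: class_avg_def norm_divide divide_right_mono norm_sum)

lemma sum_class_avg:
  fixes h :: "'p \<Rightarrow> 'a::real_normed_field"
  assumes "class_map X \<pi>"
  shows "(\<Sum>p\<in>X. class_avg \<pi> h p) = sum h X"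
proof -
  have "(\<Sum>p\<in>X. class_avg \<pi> h p) = (\<Sum>p\<in>X. \<Sum>q\<in>\<pi> p. h q / of_nat (card (\<pi> p)))"
    by (simp add: class_avg_def sum_divide_distrib)
  also have "\<dots> = (\<Sum>q\<in>X. \<Sum>p\<in>\<pi> q. h q / of_nat (card (\<pi> p)))"
    by (rule sum_class_swap[OF assms])
  also have "\<dots> = (\<Sum>q\<in>X. \<Sum>p\<in>\<pi> q. h q / of_nat (card (\<pi> q)))"
    using class_map_eq[OF assms] by (intro sum.cong refl) metis
  also have "\<dots> = sum h X"
    using class_map_card_pos[OF assms] by (intro sum.cong) auto
  finally show ?thesis .
qed

lemma sum_norm_class_avg_le:
  assumes "class_map X \<pi>"
  shows "(\<Sum>p\<in>X. norm (class_avg \<pi> h p)) \<le> (\<Sum>p\<in>X. norm (h p))"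
proof -
  have "(\<Sum>p\<in>X. norm (class_avg \<pi> h p)) \<le> (\<Sum>p\<in>X. class_avg \<pi> (\<lambda>q. norm (h q)) p)"
    by (intro sum_mono norm_class_avg_le)
  then show ?thesis by (simp add: sum_class_avg[OF assms])
qed

lemma sum_class_avg_class:
  assumes "class_map X \<pi>" "p \<in> X"
  shows "sum (class_avg \<pi> h) (\<pi> p) = sum h (\<pi> p)"
proof -
  have "sum (class_avg \<pi> h) (\<pi> p) = (\<Sum>q\<in>\<pi> p. class_avg \<pi> h p)"
    using class_map_eq[OF assms] by (intro sum.cong refl) (simp add: class_avg_def)
  also have "\<dots> = sum h (\<pi> p)"
    using class_map_card_pos[OF assms] by (simp add: class_avg_def)
  finally show ?thesis .
qed

text \<open>The cancellation used for mean zero parts: within a class the invariant factor comes out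
  of the sum, and what remains vanishes.\<close>

lemma sum_mult_invariant_eq_0:
  fixes \<beta> K :: "'p \<Rightarrow> complex"
  assumes "class_map X \<pi>" and "\<And>p. p \<in> X \<Longrightarrow> sum \<beta> (\<pi> p) = 0"
    and "\<And>p q. p \<in> X \<Longrightarrow> q \<in> \<pi> p \<Longrightarrow> K q = K p"
  shows "(\<Sum>p\<in>X. \<beta> p * K p) = 0"
proof -
  have "(\<Sum>p\<in>\<pi> x. \<beta> p * K p) = 0" if "x \<in> X" for x
  proof -
    have "(\<Sum>p\<in>\<pi> x. \<beta> p * K p) = (\<Sum>p\<in>\<pi> x. \<beta> p * K x)"
      using assms(3) that by (intro sum.cong) auto
    then show ?thesis using assms(2)[OF that] by (simp flip: sum_distrib_right)
  qed
  then have "\<forall>R\<in>\<pi> ` X. (\<Sum>p\<in>R. \<beta> p * K p) = 0" by blast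
  then show ?thesis
    by (subst sum_classes[OF assms(1)]) (rule sum.neutral)
qed

section \<open>Trees of cells and stopping times\<close>

text \<open>An abstract dyadic filtration: generation 0 consists of singletons, and cells grow with
  \<open>j\<close>. No top cell is fixed, so estimates are localized to some
  \<open>cell J p0\<close>. The constant \<open>b\<close> bounds the growth of cells from one
  generation to the next; it is \<open>2 ^ d\<close> for cubes.\<close>

locale cell_tree =
  fixes cell :: "nat \<Rightarrow> 'p \<Rightarrow> 'p set" and b :: real
  assumes cell_0: "cell 0 p = {p}"
    and finite_cell: "finite (cell j p)"
    and cell_eq: "q \<in> cell j p \<Longrightarrow> cell j q = cell j p"
    and cell_Suc: "cell j p \<subseteq> cell (Suc j) p"
    and card_cell_Suc: "real (card (cell (Suc j) p)) \<le> b * real (card (cell j p))"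
begin

lemma cell_mono: "i \<le> j \<Longrightarrow> cell i p \<subseteq> cell j p"
  by (rule lift_Suc_mono_le[of "\<lambda>j. cell j p"]) (rule cell_Suc)

lemma self_in_cell: "p \<in> cell j p"
  using cell_mono[of 0 j p] by (simp add: cell_0)

lemma cell_eq_mono: "q \<in> cell i p \<Longrightarrow> i \<le> j \<Longrightarrow> cell j q = cell j p"
  using cell_mono cell_eq by blast

lemma cell_sym: "q \<in> cell j p \<longleftrightarrow> p \<in> cell j q"
  using cell_eq self_in_cell by metis

lemma card_cell_pos: "0 < card (cell j p)"
  using self_in_cell[of p j] finite_cell[of j p] by (auto simp: card_gt_0_iff)

lemma class_map_cell: "j \<le> J \<Longrightarrow> class_map (cell J p0) (cell j)"
  unfolding class_map_def
  by (metis cell_eq cell_mono finite_cell self_in_cell)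

lemma sum_cell_pos:
  fixes \<sigma> :: "'p \<Rightarrow> real"
  assumes "\<And>p. 0 < \<sigma> p"
  shows "0 < sum \<sigma> (cell j p)"
  using assms self_in_cell[of p j] finite_cell[of j p] by (intro sum_pos) auto

text \<open>\<open>cell (\<tau> p) p\<close> is the stopping cell of \<open>p\<close>; asking that
  \<tau> be constant on it makes the stopping cells a partition.\<close>

definition stopping :: "('p \<Rightarrow> nat) \<Rightarrow> bool" where
  "stopping \<tau> \<longleftrightarrow> (\<forall>p. \<forall>q\<in>cell (\<tau> p) p. \<tau> q = \<tau> p)"

text \<open>If \<open>q\<close> stopped below generation \<open>j\<close> and \<open>p\<close> did
  not, the stopping cell of \<open>p\<close> would contain \<open>q\<close> and force equal stopping
  generations. So lying strictly above the stopping cells is a property of cells, not of points, and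
  the cells above them define a restricted shift.\<close>

lemma stopping_less_iff:
  assumes "stopping \<tau>" "q \<in> cell j p"
  shows "\<tau> q < j \<longleftrightarrow> \<tau> p < j"
proof -
  have *: "\<tau> x < j" if "\<tau> y < j" "y \<in> cell j x" for x y
  proof (rule ccontr)
    assume "\<not> \<tau> x < j"
    then have "y \<in> cell (\<tau> x) x" using that cell_mono[of j "\<tau> x" x] by auto
    then have "\<tau> y = \<tau> x" using assms(1) that by (auto simp: stopping_def)
    then show False using that \<open>\<not> \<tau> x < j\<close> by simp
  qed
  show ?thesis using *[of p q] *[of q p] assms cell_sym by blast
qed

lemma class_map_stopping:
  assumes "stopping \<tau>" "\<And>p. p \<in> cell j p0 \<Longrightarrow> \<tau> p \<le> j"
  shows "class_map (cell j p0) (\<lambda>p. cell (\<tau> p) p)"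
  unfolding class_map_def
proof (intro conjI ballI)
  fix p assume p: "p \<in> cell j p0"
  show "cell (\<tau> p) p \<subseteq> cell j p0"
    using cell_mono[of "\<tau> p" j p] assms(2)[OF p] cell_eq[OF p] by auto
  fix q assume q: "q \<in> cell (\<tau> p) p"
  then have "\<tau> q = \<tau> p" using assms p by (auto simp: stopping_def)
  then show "cell (\<tau> q) q = cell (\<tau> p) p" using cell_eq[OF q] by simp
qed (auto simp: finite_cell self_in_cell)

text \<open>Stops at the largest selected cell of generation at most \<open>J\<close>. Where there
  is none, the default value 0 makes the stopping cell a singleton.\<close>

lemma ex_stopping:
  assumes inv: "\<And>j p q. q \<in> cell j p \<Longrightarrow> S j q = S j p"
  obtains \<tau> where "stopping \<tau>" "\<And>p. \<tau> p \<le> J" "\<And>p j. \<tau> p < j \<Longrightarrow> j \<le> J \<Longrightarrow> \<not> S j p"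
    "\<And>p. \<tau> p = 0 \<or> S (\<tau> p) p"
proof
  define P where "P p j \<longleftrightarrow> j \<le> J \<and> (j = 0 \<or> S j p)" for p j
  define \<tau> where "\<tau> p = (GREATEST j. P p j)" for p
  have P0: "P p 0" for p by (simp add: P_def)
  have bd: "\<forall>y. P p y \<longrightarrow> y \<le> J" for p by (simp add: P_def)
  have P\<tau>: "P p (\<tau> p)" for p unfolding \<tau>_def by (rule GreatestI_nat[of _ 0 J]) (use P0 bd in auto)
  have le: "j \<le> \<tau> p" if "P p j" for p j unfolding \<tau>_def by (rule Greatest_le_nat[of _ j J]) (use that bd in auto)
  show "\<tau> p \<le> J" for p using P\<tau> by (simp add: P_def)
  show "\<tau> p = 0 \<or> S (\<tau> p) p" for p using P\<tau>[of p] by (simp add: P_def)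
  show "\<not> S j p" if "\<tau> p < j" "j \<le> J" for p j
    using le[of p j] that by (auto simp: P_def)
  show "stopping \<tau>"
    unfolding stopping_def
  proof (intro allI ballI)
    fix p q assume q: "q \<in> cell (\<tau> p) p"
    show "\<tau> q = \<tau> p"
    proof (cases "\<tau> p = 0")
      case True
      then show ?thesis using q by (simp add: cell_0)
    next
      case False
      \<comment> \<open>From generation \<open>\<tau> p\<close> on, \<open>p\<close> and
        \<open>q\<close> share their cells, so the candidates agree there and each maximum bounds
        the other.\<close>
      have "P q j = P p j" if "\<tau> p \<le> j" for j
        using inv[of q j p] cell_mono[OF that, of p] q by (auto simp: P_def)
      then show ?thesis
        using P\<tau>[of p] P\<tau>[of q] le[of q "\<tau> p"] le[of p "\<tau> q"] by (meson le_antisym order_refl)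
    qed
  qed
qed

section \<open>Bilinear forms above the stopping cells\<close>

text \<open>
  \<open>A j p q\<close> is the kernel of the cell \<open>cell j p\<close>, relevant only for \<open>q \<in> cell j p\<close>; one
  function thus describes all cells of generation \<open>j\<close> at once.
\<close>

definition shift_ker :: "nat \<Rightarrow> (nat \<Rightarrow> 'p \<Rightarrow> 'p \<Rightarrow> complex) \<Rightarrow> bool" where
  "shift_ker r A \<longleftrightarrow>
     (\<forall>j p q. q \<in> cell j p \<longrightarrow> norm (A j p q) \<le> 1 / card (cell j p)) \<and>
     (\<forall>i j p p' q q'. i + r < j \<longrightarrow> p' \<in> cell i p \<longrightarrow> q' \<in> cell i q \<longrightarrow> A j p' q' = A j p q)"

text \<open>Allows the cancellation to be used in either argument of the form. Both conditions are
  symmetric because members of a cell have the same cell.\<close>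

lemma shift_ker_transpose: "shift_ker r A \<Longrightarrow> shift_ker r (\<lambda>j p q. A j q p)"
  unfolding shift_ker_def using cell_eq cell_sym by (intro conjI allI impI) (metis, blast)

text \<open>Points of a common cell of generation \<open>j\<close> agree on whether \<open>j\<close>
  exceeds their stopping generation, so the index set is symmetric in \<open>p\<close> and
  \<open>q\<close>.\<close>

lemma form_swap:
  assumes "stopping \<tau>"
  shows "(\<Sum>p\<in>cell J p0. \<Sum>j\<in>{\<tau> p<..J}. \<Sum>q\<in>cell j p. h j p q) =
         (\<Sum>q\<in>cell J p0. \<Sum>j\<in>{\<tau> q<..J}. \<Sum>p\<in>cell j q. (h j p q :: complex))"
proof -
  let ?X = "cell J p0"
  \<comment> \<open>The range of \<open>j\<close> depends on \<open>p\<close>; a conditional over a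
    fixed range makes the sums commute.\<close>
  have 1: "(\<Sum>j\<in>{\<tau> p<..J}. k j) = (\<Sum>j\<le>J. if \<tau> p < j then k j else 0)" for p and k :: "nat \<Rightarrow> complex"
    by (subst sum.inter_filter[symmetric]) (auto intro!: sum.cong)
  have "(\<Sum>p\<in>?X. \<Sum>j\<in>{\<tau> p<..J}. \<Sum>q\<in>cell j p. h j p q) =
        (\<Sum>j\<le>J. \<Sum>p\<in>?X. \<Sum>q\<in>cell j p. if \<tau> p < j then h j p q else 0)"
    unfolding 1 by (subst sum.swap) (auto intro!: sum.cong)
  also have "\<dots> = (\<Sum>j\<le>J. \<Sum>q\<in>?X. \<Sum>p\<in>cell j q. if \<tau> p < j then h j p q else 0)"
    by (intro sum.cong refl sum_class_swap class_map_cell) auto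
  also have "\<dots> = (\<Sum>j\<le>J. \<Sum>q\<in>?X. \<Sum>p\<in>cell j q. if \<tau> q < j then h j p q else 0)"
  proof (intro sum.cong refl)
    fix j q p assume *: "j \<in> {..J}" "q \<in> ?X" "p \<in> cell j q"
    show "(if \<tau> p < j then h j p q else 0) = (if \<tau> q < j then h j p q else 0)"
      using stopping_less_iff[OF assms *(3)] by simp
  qed
  also have "\<dots> = (\<Sum>q\<in>?X. \<Sum>j\<in>{\<tau> q<..J}. \<Sum>p\<in>cell j q. h j p q)"
    unfolding 1 by (subst sum.swap) (auto intro!: sum.cong)
  finally show ?thesis .
qed

text \<open>The kernel is at most one over the size of the cell, so one generation of the transposed
  operator is dominated by an average of |g|.\<close>

lemma norm_kernel_sum_le:
  fixes c :: real
  assumes "shift_ker r A" "(\<Sum>p\<in>cell j q. norm (g p)) \<le> c * card (cell j q)"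
  shows "norm (\<Sum>p\<in>cell j q. A j p q * g p) \<le> c"
proof -
  have "norm (\<Sum>p\<in>cell j q. A j p q * g p) \<le> (\<Sum>p\<in>cell j q. 1 / card (cell j q) * norm (g p))"
  proof (intro order_trans[OF norm_sum] sum_mono)
    fix p assume "p \<in> cell j q"
    then have "norm (A j p q) \<le> 1 / card (cell j q)"
      using assms(1) cell_eq[of p j q] cell_sym[of p j q] unfolding shift_ker_def by metis
    then show "norm (A j p q * g p) \<le> 1 / card (cell j q) * norm (g p)"
      unfolding norm_mult by (rule mult_right_mono) simp
  qed
  also have "\<dots> = (\<Sum>p\<in>cell j q. norm (g p)) / card (cell j q)"
    by (simp add: sum_divide_distrib)
  also have "\<dots> \<le> c"
    using assms(2) card_cell_pos[of j q] by (simp add: divide_le_eq)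
  finally show ?thesis .
qed

text \<open>On a stopping cell the kernels of generations beyond \<open>\<tau> q + r\<close> are
  constant and annihilate \<beta>. At most \<open>r\<close> generations remain, each contributing at
  most \<open>c\<close> times the sum of |\<beta>|.\<close>

lemma cancellative_form_bound:
  fixes c :: real
  assumes ker: "shift_ker r A" and st: "stopping \<tau>" and le: "\<And>p. \<tau> p \<le> J"
    and \<beta>: "\<And>p. p \<in> cell J p0 \<Longrightarrow> sum \<beta> (cell (\<tau> p) p) = 0"
    and c: "0 \<le> c"
    and g: "\<And>q j. q \<in> cell J p0 \<Longrightarrow> \<tau> q < j \<Longrightarrow> j \<le> J \<Longrightarrow>
              (\<Sum>p\<in>cell j q. norm (g p)) \<le> c * card (cell j q)"
  shows "norm (\<Sum>p\<in>cell J p0. \<Sum>j\<in>{\<tau> p<..J}. \<Sum>q\<in>cell j p. A j p q * \<beta> q * g p)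
           \<le> r * c * (\<Sum>p\<in>cell J p0. norm (\<beta> p))"
proof -
  let ?X = "cell J p0"
  define H where "H j q = (\<Sum>p\<in>cell j q. A j p q * g p)" for j q
  have cm: "class_map ?X (\<lambda>p. cell (\<tau> p) p)"
    by (rule class_map_stopping[OF st]) (use le in auto)
  \<comment> \<open>generations above \<open>\<tau> q + r\<close>: there the kernel is constant on the stopping cell\<close>
  have far: "(\<Sum>q\<in>?X. \<beta> q * (\<Sum>j\<in>{\<tau> q + r<..J}. H j q)) = 0"
  proof (rule sum_mult_invariant_eq_0[OF cm \<beta>])
    fix p q assume p: "p \<in> ?X" and q: "q \<in> cell (\<tau> p) p"
    have \<tau>: "\<tau> q = \<tau> p" using st p q by (auto simp: stopping_def)
    have "H j q = H j p" if "\<tau> p + r < j" for j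
    proof -
      have "cell j q = cell j p" using cell_eq_mono[OF q] that by simp
      moreover have "A j x q = A j x p" for x
        using ker that q self_in_cell[of x "\<tau> p"] unfolding shift_ker_def by blast
      ultimately show ?thesis by (simp add: H_def)
    qed
    then show "(\<Sum>j\<in>{\<tau> q + r<..J}. H j q) = (\<Sum>j\<in>{\<tau> p + r<..J}. H j p)"
      by (simp add: \<tau>)
  qed
  have near: "norm (\<Sum>j\<in>{\<tau> q<..min J (\<tau> q + r)}. H j q) \<le> r * c" if q: "q \<in> ?X" for q
  proof -
    have "norm (\<Sum>j\<in>{\<tau> q<..min J (\<tau> q + r)}. H j q) \<le> (\<Sum>j\<in>{\<tau> q<..min J (\<tau> q + r)}. c)"
      unfolding H_def
      by (intro order_trans[OF norm_sum] sum_mono norm_kernel_sum_le[OF ker] g[OF q]) auto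
    also have "\<dots> \<le> r * c"
      using c by (auto intro!: mult_right_mono)
    finally show ?thesis .
  qed
  have split: "(\<Sum>j\<in>{\<tau> q<..J}. H j q) =
      (\<Sum>j\<in>{\<tau> q<..min J (\<tau> q + r)}. H j q) + (\<Sum>j\<in>{\<tau> q + r<..J}. H j q)" for q
    by (subst sum.union_disjoint[symmetric]) (auto intro!: sum.cong)
  have "(\<Sum>p\<in>?X. \<Sum>j\<in>{\<tau> p<..J}. \<Sum>q\<in>cell j p. A j p q * \<beta> q * g p) =
        (\<Sum>q\<in>?X. \<Sum>j\<in>{\<tau> q<..J}. \<Sum>p\<in>cell j q. A j p q * \<beta> q * g p)"
    by (rule form_swap[OF st])
  also have "\<dots> = (\<Sum>q\<in>?X. \<beta> q * (\<Sum>j\<in>{\<tau> q<..J}. H j q))"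
    by (simp add: H_def sum_distrib_left mult_ac)
  also have "\<dots> = (\<Sum>q\<in>?X. \<beta> q * (\<Sum>j\<in>{\<tau> q<..min J (\<tau> q + r)}. H j q))"
    unfolding split by (simp add: distrib_left sum.distrib far)
  also have "norm \<dots> \<le> (\<Sum>q\<in>?X. norm (\<beta> q) * (r * c))"
    by (intro order_trans[OF norm_sum] sum_mono) (auto simp: norm_mult intro!: mult_left_mono near)
  also have "\<dots> = r * c * (\<Sum>p\<in>?X. norm (\<beta> p))"
    by (simp add: sum_distrib_left mult_ac)
  finally show ?thesis .
qed

text \<open>Calderon-Zygmund decomposition: \<open>f\<close> and \<open>g\<close> are replaced by
  their averages over the stopping cells, to which the hypothesis \<open>L2\<close> is applied. The
  two mean zero remainders cost \<open>8 * r\<close> each, which gives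
  \<open>16 * r\<close>.\<close>

lemma stopped_form_bound:
  fixes a c B :: real
  assumes ker: "shift_ker r A" and st: "stopping \<tau>"
    and le: "\<And>p. \<tau> p \<le> J" and less: "\<And>p. p \<in> cell J p0 \<Longrightarrow> \<tau> p < J"
    and nn: "0 \<le> a" "0 \<le> c" "0 \<le> B" "0 \<le> b"
    and f: "\<And>q j. q \<in> cell J p0 \<Longrightarrow> \<tau> q < j \<Longrightarrow> j \<le> J \<Longrightarrow>
              (\<Sum>p\<in>cell j q. norm (f p)) \<le> 4 * a * card (cell j q)"
    and g: "\<And>q j. q \<in> cell J p0 \<Longrightarrow> \<tau> q < j \<Longrightarrow> j \<le> J \<Longrightarrow>
              (\<Sum>p\<in>cell j q. norm (g p)) \<le> 4 * c * card (cell j q)"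
    and fa: "(\<Sum>p\<in>cell J p0. norm (f p)) = a * card (cell J p0)"
    and gc: "(\<Sum>p\<in>cell J p0. norm (g p)) = c * card (cell J p0)"
    and L2: "\<And>h. (\<Sum>p\<in>cell J p0. (norm (\<Sum>j\<in>{\<tau> p<..J}. \<Sum>q\<in>cell j p. A j p q * h q))\<^sup>2)
                 \<le> B\<^sup>2 * (\<Sum>p\<in>cell J p0. (norm (h p))\<^sup>2)"
  shows "norm (\<Sum>p\<in>cell J p0. \<Sum>j\<in>{\<tau> p<..J}. \<Sum>q\<in>cell j p. A j p q * f q * g p)
           \<le> (4 * b * B + 16 * r) * a * c * card (cell J p0)"
proof -
  let ?X = "cell J p0"
  let ?\<pi> = "\<lambda>p. cell (\<tau> p) p"
  define n where "n = real (card ?X)"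
  define \<Phi> where "\<Phi> u v = (\<Sum>p\<in>?X. \<Sum>j\<in>{\<tau> p<..J}. \<Sum>q\<in>cell j p. A j p q * u q * v p)" for u v
  define f1 where "f1 = class_avg ?\<pi> f"
  define g1 where "g1 = class_avg ?\<pi> g"
  have cm: "class_map ?X ?\<pi>" by (rule class_map_stopping[OF st]) (use le in auto)
  have split: "\<Phi> f g = \<Phi> (\<lambda>p. f p - f1 p) g + \<Phi> f1 (\<lambda>p. g p - g1 p) + \<Phi> f1 g1"
    by (simp add: \<Phi>_def algebra_simps sum_subtractf flip: sum.distrib)
  \<comment> \<open>The cell one generation above a stopping cell is not stopped and, by
    \<open>less\<close>, still within \<open>J\<close>. Its average is at most \<open>4 * e\<close>,
    and passing to the stopping cell inside it loses the factor \<open>b\<close>.\<close>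
  have avg_bound: "norm (class_avg ?\<pi> k p) \<le> 4 * b * e"
    if k: "\<And>q j. q \<in> ?X \<Longrightarrow> \<tau> q < j \<Longrightarrow> j \<le> J \<Longrightarrow> (\<Sum>p\<in>cell j q. norm (k p)) \<le> 4 * e * card (cell j q)"
      and p: "p \<in> ?X" and e: "0 \<le> e" for k :: "'p \<Rightarrow> complex" and e :: real and p
  proof -
    have "(\<Sum>q\<in>?\<pi> p. norm (k q)) \<le> (\<Sum>q\<in>cell (Suc (\<tau> p)) p. norm (k q))"
      by (rule sum_mono2) (auto simp: finite_cell cell_Suc)
    also have "\<dots> \<le> 4 * e * card (cell (Suc (\<tau> p)) p)"
      using k[OF p, of "Suc (\<tau> p)"] less[OF p] by simp
    also have "\<dots> \<le> 4 * e * (b * card (?\<pi> p))"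
      using card_cell_Suc[of "\<tau> p" p] e by (intro mult_left_mono) auto
    finally have "class_avg ?\<pi> (\<lambda>q. norm (k q)) p \<le> 4 * b * e"
      using card_cell_pos[of "\<tau> p" p] by (simp add: class_avg_def divide_le_eq mult_ac)
    then show ?thesis using norm_class_avg_le[of ?\<pi> k p] by linarith
  qed
  \<comment> \<open>Sup bound \<open>4 * b * e\<close> times l1 norm \<open>e * n\<close>. Using the
    sup bound only once keeps the dependence on \<open>b\<close> linear.\<close>
  have avg_sq: "(\<Sum>p\<in>?X. (norm (class_avg ?\<pi> k p))\<^sup>2) \<le> 4 * b * e\<^sup>2 * n"
    if k: "\<And>q j. q \<in> ?X \<Longrightarrow> \<tau> q < j \<Longrightarrow> j \<le> J \<Longrightarrow> (\<Sum>p\<in>cell j q. norm (k p)) \<le> 4 * e * card (cell j q)"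
      and e: "0 \<le> e" and ke: "(\<Sum>p\<in>?X. norm (k p)) = e * n" for k :: "'p \<Rightarrow> complex" and e :: real
  proof -
    have "(\<Sum>p\<in>?X. (norm (class_avg ?\<pi> k p))\<^sup>2) \<le> (\<Sum>p\<in>?X. 4 * b * e * norm (class_avg ?\<pi> k p))"
      unfolding power2_eq_square using avg_bound[OF k _ e]
      by (intro sum_mono mult_right_mono) auto
    also have "\<dots> = 4 * b * e * (\<Sum>p\<in>?X. norm (class_avg ?\<pi> k p))"
      by (simp add: sum_distrib_left)
    also have "\<dots> \<le> 4 * b * e * (e * n)"
      using sum_norm_class_avg_le[OF cm, of k] ke nn e by (intro mult_left_mono) auto
    finally show ?thesis by (simp add: power2_eq_square mult_ac)
  qed
  have avg_diff: "(\<Sum>p\<in>?X. norm (k p - class_avg ?\<pi> k p)) \<le> 2 * (\<Sum>p\<in>?X. norm (k p))"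
    for k :: "'p \<Rightarrow> complex"
  proof -
    have "(\<Sum>p\<in>?X. norm (k p - class_avg ?\<pi> k p)) \<le> (\<Sum>p\<in>?X. norm (k p) + norm (class_avg ?\<pi> k p))"
      by (intro sum_mono norm_triangle_ineq4)
    then show ?thesis using sum_norm_class_avg_le[OF cm, of k] by (simp add: sum.distrib)
  qed
  have zero: "sum (\<lambda>p. k p - class_avg ?\<pi> k p) (?\<pi> x) = 0" if "x \<in> ?X" for x and k :: "'p \<Rightarrow> complex"
    using sum_class_avg_class[OF cm that, of k] by (simp add: sum_subtractf)
  have 1: "norm (\<Phi> (\<lambda>p. f p - f1 p) g) \<le> 8 * r * a * c * n"
  proof -
    have "norm (\<Phi> (\<lambda>p. f p - f1 p) g) \<le> r * (4 * c) * (\<Sum>p\<in>?X. norm (f p - f1 p))"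
      unfolding \<Phi>_def f1_def using nn
      by (intro cancellative_form_bound[OF ker st le zero _ g]) auto
    also have "\<dots> \<le> r * (4 * c) * (2 * (a * n))"
      using avg_diff[of f] nn by (intro mult_left_mono) (auto simp: f1_def fa n_def)
    finally show ?thesis by (simp add: mult_ac)
  qed
  have 2: "norm (\<Phi> f1 (\<lambda>p. g p - g1 p)) \<le> 8 * r * a * c * n"
  proof -
    \<comment> \<open>Averaging preserves the bound on cells above the stopping cells, since these
      are unions of stopping cells.\<close>
    have f1: "(\<Sum>p\<in>cell j q. norm (f1 p)) \<le> 4 * a * card (cell j q)"
      if "q \<in> ?X" "\<tau> q < j" "j \<le> J" for q j
    proof -
      have "class_map (cell j q) ?\<pi>"
        by (rule class_map_stopping[OF st]) (use stopping_less_iff[OF st] that in \<open>auto intro: less_imp_le\<close>)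
      from sum_norm_class_avg_le[OF this, of f] show ?thesis
        using f[OF that] by (simp add: f1_def)
    qed
    \<comment> \<open>Exchanging the variables reduces this to the previous situation, with the
      transposed kernel.\<close>
    have "\<Phi> f1 (\<lambda>p. g p - g1 p) =
       (\<Sum>p\<in>?X. \<Sum>j\<in>{\<tau> p<..J}. \<Sum>q\<in>cell j p. A j q p * (g q - g1 q) * f1 p)"
      unfolding \<Phi>_def by (subst form_swap[OF st]) (simp add: mult_ac)
    also have "norm \<dots> \<le> r * (4 * a) * (\<Sum>p\<in>?X. norm (g p - g1 p))"
      unfolding g1_def using nn
      by (intro cancellative_form_bound[OF shift_ker_transpose[OF ker] st le zero _ f1]) auto
    also have "\<dots> \<le> r * (4 * a) * (2 * (c * n))"
      using avg_diff[of g] nn by (intro mult_left_mono) (auto simp: g1_def gc n_def)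
    finally show ?thesis by (simp add: mult_ac)
  qed
  \<comment> \<open>Cauchy-Schwarz and the unweighted bound; each of the two averaged functions
    contributes a factor \<open>sqrt (4 * b)\<close>.\<close>
  have 3: "norm (\<Phi> f1 g1) \<le> 4 * b * B * a * c * n"
  proof -
    define T where "T p = (\<Sum>j\<in>{\<tau> p<..J}. \<Sum>q\<in>cell j p. A j p q * f1 q)" for p
    have "\<Phi> f1 g1 = (\<Sum>p\<in>?X. T p * g1 p)"
      by (simp add: \<Phi>_def T_def sum_distrib_right)
    also have "norm \<dots> \<le> (\<Sum>p\<in>?X. \<bar>norm (T p)\<bar> * \<bar>norm (g1 p)\<bar>)"
      by (intro order_trans[OF norm_sum] sum_mono) (simp add: norm_mult)
    also have "\<dots> \<le> L2_set (\<lambda>p. norm (T p)) ?X * L2_set (\<lambda>p. norm (g1 p)) ?X"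
      by (rule L2_set_mult_ineq)
    also have "\<dots> \<le> sqrt (B\<^sup>2 * (4 * b * a\<^sup>2 * n)) * sqrt (4 * b * c\<^sup>2 * n)"
    proof (unfold L2_set_def, intro mult_mono real_sqrt_le_mono)
      have "(\<Sum>p\<in>?X. (norm (T p))\<^sup>2) \<le> B\<^sup>2 * (\<Sum>p\<in>?X. (norm (f1 p))\<^sup>2)"
        unfolding T_def by (rule L2)
      also have "\<dots> \<le> B\<^sup>2 * (4 * b * a\<^sup>2 * n)"
        unfolding f1_def using nn fa by (intro mult_left_mono avg_sq f) (auto simp: n_def)
      finally show "(\<Sum>p\<in>?X. (norm (T p))\<^sup>2) \<le> B\<^sup>2 * (4 * b * a\<^sup>2 * n)" .
      show "(\<Sum>p\<in>?X. (norm (g1 p))\<^sup>2) \<le> 4 * b * c\<^sup>2 * n"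
        unfolding g1_def using nn gc by (intro avg_sq g) (auto simp: n_def)
    qed (use nn in \<open>auto simp: n_def intro!: sum_nonneg\<close>)
    also have "\<dots> = sqrt ((4 * b * B * a * c * n)\<^sup>2)"
      by (simp flip: real_sqrt_mult add: power2_eq_square mult_ac)
    also have "\<dots> = 4 * b * B * a * c * n"
      using nn by (simp add: n_def)
    finally show ?thesis .
  qed
  have "norm (\<Phi> f g) \<le> (4 * b * B + 16 * r) * a * c * n"
    unfolding split using norm_triangle_ineq[of "\<Phi> (\<lambda>p. f p - f1 p) g + \<Phi> f1 (\<lambda>p. g p - g1 p)" "\<Phi> f1 g1"]
      norm_triangle_ineq[of "\<Phi> (\<lambda>p. f p - f1 p) g" "\<Phi> f1 (\<lambda>p. g p - g1 p)"] 1 2 3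
    by (simp add: algebra_simps)
  then show ?thesis by (simp add: \<Phi>_def n_def)
qed

section \<open>The dyadic maximal function and Doob's inequality\<close>

text \<open>Maximal function of \<phi> / \<sigma> with respect to the measure \<sigma>, over cells
  of generation at most \<open>J\<close>: the quotient of the two sums is the \<sigma>-average of
  \<phi> / \<sigma>.\<close>

definition cell_max :: "('p \<Rightarrow> real) \<Rightarrow> ('p \<Rightarrow> real) \<Rightarrow> nat \<Rightarrow> 'p \<Rightarrow> real" where
  "cell_max \<sigma> \<phi> J p = (MAX j\<in>{..J}. sum \<phi> (cell j p) / sum \<sigma> (cell j p))"

lemma cell_max_0: "cell_max \<sigma> \<phi> 0 p = \<phi> p / \<sigma> p"
  by (simp add: cell_max_def cell_0)

lemma cell_max_Suc:
  "cell_max \<sigma> \<phi> (Suc J) p = max (sum \<phi> (cell (Suc J) p) / sum \<sigma> (cell (Suc J) p)) (cell_max \<sigma> \<phi> J p)"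
  by (simp add: cell_max_def atMost_Suc)

lemma cell_max_ge: "j \<le> J \<Longrightarrow> sum \<phi> (cell j p) / sum \<sigma> (cell j p) \<le> cell_max \<sigma> \<phi> J p"
  by (auto simp: cell_max_def intro!: Max_ge)

lemma cell_max_mono: "j \<le> J \<Longrightarrow> cell_max \<sigma> \<phi> j p \<le> cell_max \<sigma> \<phi> J p"
  unfolding cell_max_def by (rule Max_mono) auto

text \<open>
  Doob's inequality by induction on the tree, with Bellman function \<open>2t\<^sup>2 - 4tx\<close> for a running
  maximum \<open>t\<close> and a current average \<open>x \<le> t\<close>: it is linear in \<open>x\<close>, and raising \<open>t\<close> to \<open>x > t\<close>
  does not increase it.
\<close>

lemma cell_max_bellman:
  assumes \<sigma>: "\<And>p. 0 < \<sigma> p" and "sum \<phi> (cell J p0) / sum \<sigma> (cell J p0) \<le> t"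
  shows "(\<Sum>p\<in>cell J p0. (max t (cell_max \<sigma> \<phi> J p))\<^sup>2 * \<sigma> p)
           \<le> 4 * (\<Sum>p\<in>cell J p0. (\<phi> p)\<^sup>2 / \<sigma> p)
             + 2 * t\<^sup>2 * sum \<sigma> (cell J p0) - 4 * t * sum \<phi> (cell J p0)"
  using assms(2)
proof (induction J arbitrary: p0 t)
  case 0
  have s: "0 < \<sigma> p0" by (rule \<sigma>)
  \<comment> \<open>At a single point the maximum is \<open>t\<close>, and the claim is this
    completed square.\<close>
  have "0 \<le> (t * \<sigma> p0 - 2 * \<phi> p0)\<^sup>2 / \<sigma> p0" using s by simp
  also have "\<dots> = t\<^sup>2 * \<sigma> p0 + 4 * ((\<phi> p0)\<^sup>2 / \<sigma> p0) - 4 * t * \<phi> p0"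
    using s by (simp add: field_simps power2_eq_square)
  finally show ?case using 0 by (simp add: cell_0 cell_max_0 max_def algebra_simps)
next
  case (Suc J)
  let ?X = "cell (Suc J) p0"
  have cm: "class_map ?X (cell J)" by (rule class_map_cell) simp
  have top: "max t (cell_max \<sigma> \<phi> (Suc J) p) = max t (cell_max \<sigma> \<phi> J p)" if "p \<in> ?X" for p
    using Suc.prems cell_eq[OF that] by (simp add: cell_max_Suc)
  have child: "(\<Sum>p\<in>cell J x. (max t (cell_max \<sigma> \<phi> J p))\<^sup>2 * \<sigma> p)
           \<le> 4 * (\<Sum>p\<in>cell J x. (\<phi> p)\<^sup>2 / \<sigma> p)
             + 2 * t\<^sup>2 * sum \<sigma> (cell J x) - 4 * t * sum \<phi> (cell J x)" for x
  proof (cases "sum \<phi> (cell J x) / sum \<sigma> (cell J x) \<le> t")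
    case True
    then show ?thesis by (rule Suc.IH)
  next
    case False
    \<comment> \<open>The average \<open>u\<close> over the child exceeds \<open>t\<close>. Raising
      \<open>t\<close> to \<open>u\<close> leaves the maximum unchanged and lowers the Bellman term
      by 2 (u - t)^2 times the mass of the child.\<close>
    define u where "u = sum \<phi> (cell J x) / sum \<sigma> (cell J x)"
    have s: "0 < sum \<sigma> (cell J x)" using \<sigma> by (rule sum_cell_pos)
    have \<phi>: "sum \<phi> (cell J x) = u * sum \<sigma> (cell J x)" using s by (simp add: u_def)
    have eq: "max t (cell_max \<sigma> \<phi> J p) = max u (cell_max \<sigma> \<phi> J p)" if "p \<in> cell J x" for p
      using cell_max_ge[of J J \<phi> p \<sigma>] False cell_eq[OF that] by (auto simp: u_def)
    have "0 \<le> 2 * (u - t)\<^sup>2 * sum \<sigma> (cell J x)" using s by simp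
    then have "2 * u\<^sup>2 * sum \<sigma> (cell J x) - 4 * u * sum \<phi> (cell J x)
       \<le> 2 * t\<^sup>2 * sum \<sigma> (cell J x) - 4 * t * sum \<phi> (cell J x)"
      unfolding \<phi> by (simp add: algebra_simps power2_eq_square)
    moreover have "(\<Sum>p\<in>cell J x. (max t (cell_max \<sigma> \<phi> J p))\<^sup>2 * \<sigma> p)
        \<le> 4 * (\<Sum>p\<in>cell J x. (\<phi> p)\<^sup>2 / \<sigma> p)
             + 2 * u\<^sup>2 * sum \<sigma> (cell J x) - 4 * u * sum \<phi> (cell J x)"
      using Suc.IH[of x u] eq by (simp add: u_def)
    ultimately show ?thesis by simp
  qed
  have "(\<Sum>p\<in>?X. (max t (cell_max \<sigma> \<phi> (Suc J) p))\<^sup>2 * \<sigma> p) =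
        (\<Sum>R\<in>cell J ` ?X. \<Sum>p\<in>R. (max t (cell_max \<sigma> \<phi> J p))\<^sup>2 * \<sigma> p)"
    using top by (subst sum_classes[OF cm, symmetric]) simp
  also have "\<dots> \<le> (\<Sum>R\<in>cell J ` ?X. 4 * (\<Sum>p\<in>R. (\<phi> p)\<^sup>2 / \<sigma> p)
             + 2 * t\<^sup>2 * sum \<sigma> R - 4 * t * sum \<phi> R)"
    by (rule sum_mono) (use child in auto)
  also have "\<dots> = 4 * (\<Sum>p\<in>?X. (\<phi> p)\<^sup>2 / \<sigma> p) + 2 * t\<^sup>2 * sum \<sigma> ?X - 4 * t * sum \<phi> ?X"
    by (simp add: sum_classes[OF cm] sum.distrib sum_subtractf sum_distrib_left)
  finally show ?case .
qed

text \<open>Start the running maximum at the average \<open>t\<close> over the top cell: the two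
  extra terms of the Bellman estimate then add up to -2 t^2 times the mass of the cell.\<close>

lemma cell_max_L2:
  assumes \<sigma>: "\<And>p. 0 < \<sigma> p"
  shows "(\<Sum>p\<in>cell J p0. (cell_max \<sigma> \<phi> J p)\<^sup>2 * \<sigma> p) \<le> 4 * (\<Sum>p\<in>cell J p0. (\<phi> p)\<^sup>2 / \<sigma> p)"
proof -
  define t where "t = sum \<phi> (cell J p0) / sum \<sigma> (cell J p0)"
  have s: "0 < sum \<sigma> (cell J p0)" using \<sigma> by (rule sum_cell_pos)
  have \<phi>: "sum \<phi> (cell J p0) = t * sum \<sigma> (cell J p0)" using s by (simp add: t_def)
  have "max t (cell_max \<sigma> \<phi> J p) = cell_max \<sigma> \<phi> J p" if "p \<in> cell J p0" for p
    using cell_max_ge[of J J \<phi> p \<sigma>] cell_eq[OF that] by (simp add: t_def)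
  then have "(\<Sum>p\<in>cell J p0. (cell_max \<sigma> \<phi> J p)\<^sup>2 * \<sigma> p) \<le> 4 * (\<Sum>p\<in>cell J p0. (\<phi> p)\<^sup>2 / \<sigma> p)
      + 2 * t\<^sup>2 * sum \<sigma> (cell J p0) - 4 * t * sum \<phi> (cell J p0)"
    using cell_max_bellman[of \<sigma> \<phi> J p0 t, OF \<sigma>] by (simp add: t_def)
  moreover have "0 \<le> 2 * t\<^sup>2 * sum \<sigma> (cell J p0)" using s by simp
  ultimately show ?thesis unfolding \<phi> by (simp add: power2_eq_square)
qed

lemma b_ge_1: "1 \<le> b"
  using card_cell_Suc[of 0 undefined] card_cell_pos[of "Suc 0" undefined]
  by (simp add: cell_0)

section \<open>Iterated stopping and the weighted estimate on the tree\<close>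

text \<open>Chebyshev's inequality for the averages over stopping cells: with threshold four,
  \<open>f\<close> and \<open>g\<close> each account for at most a quarter of the cell.\<close>

lemma card_stopped_le:
  fixes a c :: real
  assumes st: "stopping \<tau>" and le: "\<And>p. \<tau> p \<le> J" and a: "0 < a" "0 < c"
    and fa: "(\<Sum>p\<in>cell J p0. norm (f p)) = a * card (cell J p0)"
    and gc: "(\<Sum>p\<in>cell J p0. norm (g p)) = c * card (cell J p0)"
  shows "2 * card {p \<in> cell J p0.
      4 * a * card (cell (\<tau> p) p) < (\<Sum>q\<in>cell (\<tau> p) p. norm (f q)) \<or>
      4 * c * card (cell (\<tau> p) p) < (\<Sum>q\<in>cell (\<tau> p) p. norm (g q))} \<le> card (cell J p0)"
    (is "2 * card {p \<in> _. ?S p} \<le> _")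
proof -
  let ?X = "cell J p0"
  let ?\<pi> = "\<lambda>p. cell (\<tau> p) p"
  let ?F = "class_avg ?\<pi> (\<lambda>q. norm (f q))" and ?G = "class_avg ?\<pi> (\<lambda>q. norm (g q))"
  have cm: "class_map ?X ?\<pi>" by (rule class_map_stopping[OF st]) (use le in auto)
  have nn: "0 \<le> ?F p" "0 \<le> ?G p" for p by (auto simp: class_avg_def intro!: sum_nonneg divide_nonneg_nonneg)
  have "real (card {p \<in> ?X. ?S p}) = (\<Sum>p\<in>?X. if ?S p then 1 else 0)"
    by (simp add: sum.If_cases finite_cell Int_def)
  also have "\<dots> \<le> (\<Sum>p\<in>?X. ?F p / (4 * a) + ?G p / (4 * c))"
  proof (rule sum_mono)
    fix p
    have "1 \<le> ?F p / (4 * a)" if "4 * a * card (?\<pi> p) < (\<Sum>q\<in>?\<pi> p. norm (f q))"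
      using that a card_cell_pos[of "\<tau> p" p] by (simp add: class_avg_def field_simps)
    moreover have "1 \<le> ?G p / (4 * c)" if "4 * c * card (?\<pi> p) < (\<Sum>q\<in>?\<pi> p. norm (g q))"
      using that a card_cell_pos[of "\<tau> p" p] by (simp add: class_avg_def field_simps)
    moreover have "0 \<le> ?F p / (4 * a)" "0 \<le> ?G p / (4 * c)" using nn[of p] a by auto
    ultimately show "(if ?S p then 1 else 0) \<le> ?F p / (4 * a) + ?G p / (4 * c)"
      by (smt (verit))
  qed
  also have "\<dots> = (\<Sum>p\<in>?X. ?F p) / (4 * a) + (\<Sum>p\<in>?X. ?G p) / (4 * c)"
    by (simp add: sum.distrib sum_divide_distrib)
  also have "\<dots> = card ?X / 2"
    using a by (simp add: sum_class_avg[OF cm] fa gc)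
  finally show ?thesis by simp
qed

text \<open>Strong induction on \<open>J\<close>. Cells above the stopping cells are charged to the
  unstopped points, smaller cells to the stopped points by induction, so no point is charged twice.
  In the hypothesis \<open>L2\<close>, the predicate \<open>G\<close> selects the cells of a
  restricted shift.\<close>

lemma form_le_maximal:
  fixes B W :: real
  assumes ker: "shift_ker r A" and A0: "\<And>p q. A 0 p q = 0" and B: "0 \<le> B"
    and L2: "\<And>J p0 G h. (\<And>j p q. q \<in> cell j p \<Longrightarrow> G j q = G j p) \<Longrightarrow>
      (\<Sum>p\<in>cell J p0. (norm (\<Sum>j\<in>{j. G j p \<and> j \<le> J}. \<Sum>q\<in>cell j p. A j p q * h q))\<^sup>2)
         \<le> B\<^sup>2 * (\<Sum>p\<in>cell J p0. (norm (h p))\<^sup>2)"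
    and pos: "\<And>p. 0 < \<sigma> p" "\<And>p. 0 < w p"
    and A2: "\<And>j p. sum w (cell j p) * sum \<sigma> (cell j p) \<le> W * (real (card (cell j p)))\<^sup>2"
  shows "norm (\<Sum>p\<in>cell J p0. \<Sum>j\<le>J. \<Sum>q\<in>cell j p. A j p q * f q * g p)
      \<le> 2 * (4 * b * B + 16 * r) * W *
        (\<Sum>p\<in>cell J p0. cell_max \<sigma> (\<lambda>q. norm (f q)) J p * cell_max w (\<lambda>q. norm (g q)) J p)"
proof (induction J arbitrary: p0 rule: less_induct)
  case (less J)
  let ?X = "cell J p0"
  define F where "F j p = cell_max \<sigma> (\<lambda>q. norm (f q)) j p" for j p
  define G where "G j p = cell_max w (\<lambda>q. norm (g q)) j p" for j p
  define K where "K = 4 * b * B + 16 * r"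
  define n where "n = real (card ?X)"
  have n: "0 < n" using card_cell_pos by (simp add: n_def)
  have K: "0 \<le> K" using B b_ge_1 by (simp add: K_def)
  have W: "0 \<le> W"
    using A2[of 0 p0] mult_pos_pos[OF pos(2)[of p0] pos(1)[of p0]] by (simp add: cell_0)
  have F_ge: "(\<Sum>q\<in>cell j p. norm (f q)) / sum \<sigma> (cell j p) \<le> F i p" if "j \<le> i" for i j p
    unfolding F_def by (rule cell_max_ge[OF that])
  have G_ge: "(\<Sum>q\<in>cell j p. norm (g q)) / sum w (cell j p) \<le> G i p" if "j \<le> i" for i j p
    unfolding G_def by (rule cell_max_ge[OF that])
  have F0: "0 \<le> F j p" for j p
    by (rule order_trans[OF _ F_ge[OF order_refl]]) (intro divide_nonneg_pos sum_nonneg norm_ge_zero sum_cell_pos pos)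
  have G0: "0 \<le> G j p" for j p
    by (rule order_trans[OF _ G_ge[OF order_refl]]) (intro divide_nonneg_pos sum_nonneg norm_ge_zero sum_cell_pos pos)
  define a where "a = (\<Sum>q\<in>?X. norm (f q)) / n"
  define c where "c = (\<Sum>q\<in>?X. norm (g q)) / n"
  have a: "(\<Sum>q\<in>?X. norm (f q)) = a * n" "0 \<le> a" using n by (auto simp: a_def sum_nonneg)
  have c: "(\<Sum>q\<in>?X. norm (g q)) = c * n" "0 \<le> c" using n by (auto simp: c_def sum_nonneg)
  have goal: "norm (\<Sum>p\<in>?X. \<Sum>j\<le>J. \<Sum>q\<in>cell j p. A j p q * f q * g p)
      \<le> 2 * K * W * (\<Sum>p\<in>?X. F J p * G J p)"
  proof (cases "a = 0 \<or> c = 0 \<or> J = 0")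
    \<comment> \<open>The form vanishes: \<open>f\<close> or \<open>g\<close> is zero on the cell,
      or only generation 0 with its zero kernel is present.\<close>
    case True
    have rhs: "0 \<le> 2 * K * W * (\<Sum>p\<in>?X. F J p * G J p)"
      using K W F0 G0 by (auto intro!: mult_nonneg_nonneg sum_nonneg)
    have f0: "f q = 0" if "a = 0" "q \<in> ?X" for q
      using a(1) that by (simp add: sum_nonneg_eq_0_iff finite_cell)
    have g0: "g q = 0" if "c = 0" "q \<in> ?X" for q
      using c(1) that by (simp add: sum_nonneg_eq_0_iff finite_cell)
    have sub: "q \<in> ?X" if "p \<in> ?X" "j \<le> J" "q \<in> cell j p" for p q j
      using that cell_mono[of j J p] cell_eq[of p J p0] by auto
    have "(\<Sum>p\<in>?X. \<Sum>j\<le>J. \<Sum>q\<in>cell j p. A j p q * f q * g p) = 0"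
    proof (intro sum.neutral ballI)
      fix p j q assume "p \<in> ?X" "j \<in> {..J}" "q \<in> cell j p"
      then show "A j p q * f q * g p = 0"
        using True f0[OF _ sub[of p j q]] g0[of p] A0 by auto
    qed
    then show ?thesis using rhs by simp
  next
    case False
    then have pos_ac: "0 < a" "0 < c" "0 < J" using a c by auto
    define S where "S j p \<longleftrightarrow> 4 * a * card (cell j p) < (\<Sum>q\<in>cell j p. norm (f q)) \<or>
                            4 * c * card (cell j p) < (\<Sum>q\<in>cell j p. norm (g q))" for j p
    obtain \<tau> where \<tau>: "stopping \<tau>" "\<And>p. \<tau> p \<le> J" "\<And>p j. \<tau> p < j \<Longrightarrow> j \<le> J \<Longrightarrow> \<not> S j p"
      "\<And>p. \<tau> p = 0 \<or> S (\<tau> p) p"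
    proof (rule ex_stopping[of S J])
      show "S j q = S j p" if "q \<in> cell j p" for j p q using cell_eq[OF that] by (simp add: S_def)
    qed blast
    \<comment> \<open>The top cell has averages exactly \<open>a\<close> and \<open>c\<close>, so it
      is not selected. Hence all stopping cells are smaller and the induction hypothesis applies to
      them.\<close>
    have notS: "\<not> S J p" if "p \<in> ?X" for p
      using cell_eq[OF that] a c pos_ac n by (simp add: S_def flip: n_def)
    have less_J: "\<tau> p < J" if "p \<in> ?X" for p
      using \<tau>(2)[of p] \<tau>(4)[of p] notS[OF that] pos_ac by (cases "\<tau> p = J") auto
    let ?\<pi> = "\<lambda>p. cell (\<tau> p) p"
    have cm: "class_map ?X ?\<pi>" by (rule class_map_stopping[OF \<tau>(1)]) (use \<tau> in auto)
    define Z where "Z = {p \<in> ?X. S (\<tau> p) p}"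
    have Z: "2 * card Z \<le> card ?X"
      unfolding Z_def S_def by (rule card_stopped_le[OF \<tau>(1,2) pos_ac(1,2)]) (use a c in \<open>auto simp: n_def\<close>)
    have Z_inv: "q \<in> Z \<longleftrightarrow> p \<in> Z" if "p \<in> ?X" "q \<in> ?\<pi> p" for p q
    proof -
      have "\<tau> q = \<tau> p" using \<tau>(1) that by (auto simp: stopping_def)
      moreover have "q \<in> ?X" using cm that unfolding class_map_def by blast
      ultimately show ?thesis using that cell_eq[OF that(2)] by (simp add: Z_def S_def)
    qed
    have top: "norm (\<Sum>p\<in>?X. \<Sum>j\<in>{\<tau> p<..J}. \<Sum>q\<in>cell j p. A j p q * f q * g p)
        \<le> 2 * K * W * (\<Sum>p\<in>?X - Z. F J p * G J p)"
    proof -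
      define s where "s = sum \<sigma> ?X"
      define v where "v = sum w ?X"
      have s: "0 < s" "0 < v" using sum_cell_pos pos by (auto simp: s_def v_def)
      have "norm (\<Sum>p\<in>?X. \<Sum>j\<in>{\<tau> p<..J}. \<Sum>q\<in>cell j p. A j p q * f q * g p) \<le> K * a * c * n"
        unfolding K_def n_def
      proof (rule stopped_form_bound[OF ker \<tau>(1,2) less_J])
        fix h
        have "{\<tau> p<..J} = {j. \<tau> p < j \<and> j \<le> J}" for p by auto
        then show "(\<Sum>p\<in>?X. (norm (\<Sum>j\<in>{\<tau> p<..J}. \<Sum>q\<in>cell j p. A j p q * h q))\<^sup>2)
                 \<le> B\<^sup>2 * (\<Sum>p\<in>?X. (norm (h p))\<^sup>2)"
          using L2[where G = "\<lambda>j p. \<tau> p < j" and J = J and h = h] stopping_less_iff[OF \<tau>(1)] by simp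
      qed (use a c B b_ge_1 \<tau>(3) in \<open>auto simp: n_def S_def not_less\<close>)
      \<comment> \<open>Brings in the \<sigma>-average \<open>a * n / s\<close> and the
        \<open>w\<close>-average \<open>c * n / v\<close>; the product \<open>v * s\<close> left
        over is what the hypothesis \<open>A2\<close> bounds.\<close>
      also have "K * a * c * n = K * ((a * n / s) * (c * n / v) * (v * s) / n)"
        using s n by (simp add: field_simps)
      also have "\<dots> \<le> K * ((a * n / s) * (c * n / v) * (W * n\<^sup>2) / n)"
        using K A2[of J p0] s n a c
        by (intro mult_left_mono divide_right_mono) (auto simp: s_def v_def n_def)
      also have "\<dots> = K * W * ((a * n / s) * (c * n / v)) * n"
        using n by (simp add: power2_eq_square)
      \<comment> \<open>At least half of the cell is unstopped.\<close>
      also have "\<dots> \<le> K * W * ((a * n / s) * (c * n / v)) * (2 * card (?X - Z))"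
      proof (intro mult_left_mono)
        have "card (?X - Z) = card ?X - card Z"
          by (rule card_Diff_subset) (auto simp: Z_def finite_cell)
        then show "n \<le> real (2 * card (?X - Z))" using Z by (simp add: n_def)
      qed (use K W a c s n in auto)
      also have "\<dots> = 2 * K * W * (\<Sum>p\<in>?X - Z. (a * n / s) * (c * n / v))"
        by simp
      \<comment> \<open>Both averages are over the whole cell, hence below the maximal functions at
        each of its points.\<close>
      also have "\<dots> \<le> 2 * K * W * (\<Sum>p\<in>?X - Z. F J p * G J p)"
      proof (intro mult_left_mono sum_mono mult_mono)
        fix p assume "p \<in> ?X - Z"
        then have "cell J p = ?X" using cell_eq by blast
        then show "a * n / s \<le> F J p" "c * n / v \<le> G J p"
          using F_ge[of J J p] G_ge[of J J p] by (auto simp: a c s_def v_def)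
      qed (use K W a c s n F0 in auto)
      finally show ?thesis .
    qed
    have rest: "norm (\<Sum>p\<in>?X. \<Sum>j\<le>\<tau> p. \<Sum>q\<in>cell j p. A j p q * f q * g p)
        \<le> 2 * K * W * (\<Sum>p\<in>Z. F J p * G J p)"
    proof -
      have cls: "norm (\<Sum>p\<in>?\<pi> x. \<Sum>j\<le>\<tau> p. \<Sum>q\<in>cell j p. A j p q * f q * g p)
          \<le> (\<Sum>p\<in>?\<pi> x. if p \<in> Z then 2 * K * W * (F J p * G J p) else 0)" if x: "x \<in> ?X" for x
      proof -
        have \<tau>x: "\<tau> p = \<tau> x" if "p \<in> ?\<pi> x" for p using \<tau>(1) that by (auto simp: stopping_def)
        show ?thesis
        proof (cases "S (\<tau> x) x")
          case True
          then have "x \<in> Z" using x by (simp add: Z_def)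
          have "norm (\<Sum>p\<in>?\<pi> x. \<Sum>j\<le>\<tau> p. \<Sum>q\<in>cell j p. A j p q * f q * g p)
             = norm (\<Sum>p\<in>?\<pi> x. \<Sum>j\<le>\<tau> x. \<Sum>q\<in>cell j p. A j p q * f q * g p)"
            by (simp add: \<tau>x)
          also have "\<dots> \<le> 2 * K * W * (\<Sum>p\<in>?\<pi> x. F (\<tau> x) p * G (\<tau> x) p)"
            unfolding K_def F_def G_def by (rule less.IH[OF less_J[OF x]])
          also have "\<dots> \<le> 2 * K * W * (\<Sum>p\<in>?\<pi> x. F J p * G J p)"
            using K W \<tau>(2)[of x] F0 G0
            by (intro mult_left_mono sum_mono mult_mono) (auto simp: F_def G_def intro!: cell_max_mono)
          also have "\<dots> = (\<Sum>p\<in>?\<pi> x. if p \<in> Z then 2 * K * W * (F J p * G J p) else 0)"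
            using Z_inv[OF x] \<open>x \<in> Z\<close> by (simp add: sum_distrib_left)
          finally show ?thesis .
        next
          \<comment> \<open>A stopping cell that was not selected is a singleton and carries only
            the zero kernel of generation 0.\<close>
          case False
          then have "\<tau> x = 0" using \<tau>(4) by blast
          then have "(\<Sum>p\<in>?\<pi> x. \<Sum>j\<le>\<tau> p. \<Sum>q\<in>cell j p. A j p q * f q * g p) = 0"
            by (simp add: cell_0 A0)
          moreover have "0 \<le> (\<Sum>p\<in>?\<pi> x. if p \<in> Z then 2 * K * W * (F J p * G J p) else 0)"
            using K W F0 G0 by (intro sum_nonneg) auto
          ultimately show ?thesis by simp
        qed
      qed
      have "norm (\<Sum>p\<in>?X. \<Sum>j\<le>\<tau> p. \<Sum>q\<in>cell j p. A j p q * f q * g p)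
        \<le> (\<Sum>R\<in>?\<pi> ` ?X. norm (\<Sum>p\<in>R. \<Sum>j\<le>\<tau> p. \<Sum>q\<in>cell j p. A j p q * f q * g p))"
        by (subst sum_classes[OF cm]) (rule norm_sum)
      also have "\<dots> \<le> (\<Sum>R\<in>?\<pi> ` ?X. \<Sum>p\<in>R. if p \<in> Z then 2 * K * W * (F J p * G J p) else 0)"
        by (rule sum_mono) (use cls in auto)
      also have "\<dots> = (\<Sum>p\<in>?X. if p \<in> Z then 2 * K * W * (F J p * G J p) else 0)"
        by (rule sum_classes[OF cm, symmetric])
      also have "\<dots> = (\<Sum>p\<in>{p\<in>?X. p \<in> Z}. 2 * K * W * (F J p * G J p))"
        by (rule sum.inter_filter[symmetric]) (rule finite_cell)
      also have "{p\<in>?X. p \<in> Z} = Z" by (auto simp: Z_def)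
      finally show ?thesis by (simp add: sum_distrib_left)
    qed
    have "(\<Sum>j\<le>J. k j) = (\<Sum>j\<in>{\<tau> p<..J}. k j) + (\<Sum>j\<le>\<tau> p. k j)" for p and k :: "nat \<Rightarrow> complex"
      using \<tau>(2)[of p] by (subst sum.union_disjoint[symmetric]) (auto intro!: sum.cong)
    then have "norm (\<Sum>p\<in>?X. \<Sum>j\<le>J. \<Sum>q\<in>cell j p. A j p q * f q * g p)
       = norm ((\<Sum>p\<in>?X. \<Sum>j\<in>{\<tau> p<..J}. \<Sum>q\<in>cell j p. A j p q * f q * g p)
          + (\<Sum>p\<in>?X. \<Sum>j\<le>\<tau> p. \<Sum>q\<in>cell j p. A j p q * f q * g p))"
      by (simp flip: sum.distrib)
    also have "\<dots> \<le> 2 * K * W * ((\<Sum>p\<in>?X - Z. F J p * G J p) + (\<Sum>p\<in>Z. F J p * G J p))"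
      using norm_triangle_mono[OF top rest] by (simp add: distrib_left)
    also have "(\<Sum>p\<in>?X - Z. F J p * G J p) + (\<Sum>p\<in>Z. F J p * G J p) = (\<Sum>p\<in>?X. F J p * G J p)"
      by (rule sum.subset_diff[symmetric]) (auto simp: Z_def finite_cell)
    finally show ?thesis .
  qed
  then show ?case by (simp add: F_def G_def K_def)
qed

text \<open>Duality: the form is tested on \<open>g\<close>, the conjugate of the output
  \<open>s\<close> times \<open>w\<close>. Then the form equals \<open>U\<close>, and the weighted
  norm of \<open>g\<close> is again expressed by \<open>U\<close>.\<close>

theorem weighted_bound:
  fixes B W :: real
  assumes ker: "shift_ker r A" and A0: "\<And>p q. A 0 p q = 0" and B: "0 \<le> B"
    and L2: "\<And>J p0 G h. (\<And>j p q. q \<in> cell j p \<Longrightarrow> G j q = G j p) \<Longrightarrow>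
      (\<Sum>p\<in>cell J p0. (norm (\<Sum>j\<in>{j. G j p \<and> j \<le> J}. \<Sum>q\<in>cell j p. A j p q * h q))\<^sup>2)
         \<le> B\<^sup>2 * (\<Sum>p\<in>cell J p0. (norm (h p))\<^sup>2)"
    and pos: "\<And>p. 0 < \<sigma> p" "\<And>p. 0 < w p"
    and A2: "\<And>j p. sum w (cell j p) * sum \<sigma> (cell j p) \<le> W * (real (card (cell j p)))\<^sup>2"
    and one: "\<And>p. 1 \<le> \<sigma> p * w p"
  shows "(\<Sum>p\<in>cell J p0. (norm (\<Sum>j\<le>J. \<Sum>q\<in>cell j p. A j p q * f q))\<^sup>2 * w p)
      \<le> (8 * (4 * b * B + 16 * r) * W)\<^sup>2 * (\<Sum>p\<in>cell J p0. (norm (f p))\<^sup>2 / \<sigma> p)"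
proof -
  let ?X = "cell J p0"
  define s where "s p = (\<Sum>j\<le>J. \<Sum>q\<in>cell j p. A j p q * f q)" for p
  define g where "g p = cnj (s p) * w p" for p
  define K where "K = (4 * b * B + 16 * r) * W"
  define F where "F p = cell_max \<sigma> (\<lambda>q. norm (f q)) J p" for p
  define G where "G p = cell_max w (\<lambda>q. norm (g q)) J p" for p
  define U where "U = (\<Sum>p\<in>?X. (norm (s p))\<^sup>2 * w p)"
  define V where "V = (\<Sum>p\<in>?X. (norm (f p))\<^sup>2 / \<sigma> p)"
  have UV: "0 \<le> U" "0 \<le> V" using pos by (auto simp: U_def V_def less_imp_le intro!: sum_nonneg)
  have W: "0 \<le> W"
    using A2[of 0 p0] mult_pos_pos[OF pos(2)[of p0] pos(1)[of p0]] by (simp add: cell_0)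
  have K: "0 \<le> K" using B b_ge_1 W by (simp add: K_def)
  have "complex_of_real U = (\<Sum>p\<in>?X. s p * g p)"
    unfolding U_def g_def of_real_sum
    by (intro sum.cong refl) (simp only: of_real_mult complex_norm_square mult.assoc)
  also have "\<dots> = (\<Sum>p\<in>?X. \<Sum>j\<le>J. \<Sum>q\<in>cell j p. A j p q * f q * g p)"
    by (simp add: s_def sum_distrib_right)
  finally have "U = norm (\<Sum>p\<in>?X. \<Sum>j\<le>J. \<Sum>q\<in>cell j p. A j p q * f q * g p)"
    using UV by (metis abs_of_nonneg norm_of_real)
  also have "\<dots> \<le> 2 * K * (\<Sum>p\<in>?X. F p * G p)"
    using form_le_maximal[OF ker A0 B L2 pos A2] by (simp add: F_def G_def K_def mult_ac)
  also have "\<dots> \<le> 2 * K * (\<Sum>p\<in>?X. \<bar>F p * sqrt (\<sigma> p)\<bar> * \<bar>G p * sqrt (w p)\<bar>)"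
  proof (intro mult_left_mono sum_mono)
    fix p
    \<comment> \<open>By \<open>one\<close>, inserting \<open>sqrt (\<sigma> p) * sqrt (w p)\<close>
      only increases the sum, and Cauchy-Schwarz then yields the two weighted norms of the maximal
      functions.\<close>
    have "1 \<le> sqrt (\<sigma> p) * sqrt (w p)" using one[of p] by (simp flip: real_sqrt_mult)
    then have "\<bar>F p * G p\<bar> * 1 \<le> \<bar>F p * G p\<bar> * (sqrt (\<sigma> p) * sqrt (w p))"
      by (intro mult_left_mono) auto
    then show "F p * G p \<le> \<bar>F p * sqrt (\<sigma> p)\<bar> * \<bar>G p * sqrt (w p)\<bar>"
      using pos(1)[of p] pos(2)[of p] abs_ge_self[of "F p * G p"] by (simp add: abs_mult mult_ac)
  qed (use K in auto)
  also have "\<dots> \<le> 2 * K * (L2_set (\<lambda>p. F p * sqrt (\<sigma> p)) ?X * L2_set (\<lambda>p. G p * sqrt (w p)) ?X)"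
    using K by (intro mult_left_mono L2_set_mult_ineq) auto
  also have "\<dots> = 2 * K * (sqrt (\<Sum>p\<in>?X. (F p)\<^sup>2 * \<sigma> p) * sqrt (\<Sum>p\<in>?X. (G p)\<^sup>2 * w p))"
    using pos by (simp add: L2_set_def power_mult_distrib less_imp_le)
  \<comment> \<open>Doob's inequality for both maximal functions; each costs a factor 2, which turns
    2 into 8.\<close>
  also have "\<dots> \<le> 2 * K * (sqrt (4 * V) * sqrt (4 * U))"
  proof (intro mult_left_mono mult_mono real_sqrt_le_mono)
    show "(\<Sum>p\<in>?X. (F p)\<^sup>2 * \<sigma> p) \<le> 4 * V"
      unfolding F_def V_def by (rule cell_max_L2[OF pos(1)])
    have "(\<Sum>p\<in>?X. (G p)\<^sup>2 * w p) \<le> 4 * (\<Sum>p\<in>?X. (norm (g p))\<^sup>2 / w p)"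
      unfolding G_def by (rule cell_max_L2[OF pos(2)])
    also have "(\<Sum>p\<in>?X. (norm (g p))\<^sup>2 / w p) = U"
    proof (unfold U_def, intro sum.cong refl)
      fix p show "(norm (g p))\<^sup>2 / w p = (norm (s p))\<^sup>2 * w p"
        using pos(2)[of p] by (simp add: g_def norm_mult power_mult_distrib power2_eq_square)
    qed
    finally show "(\<Sum>p\<in>?X. (G p)\<^sup>2 * w p) \<le> 4 * U" .
  qed (use K pos UV in \<open>auto intro!: sum_nonneg simp: less_imp_le\<close>)
  also have "\<dots> = 8 * K * sqrt V * sqrt U"
    by (simp add: real_sqrt_mult)
  finally have le: "U \<le> 8 * K * sqrt V * sqrt U" .
  \<comment> \<open>\<open>U\<close> occurs on both sides; cancelling \<open>sqrt U\<close> is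
    legitimate as all sums are finite.\<close>
  have "U \<le> (8 * K)\<^sup>2 * V"
  proof (cases "U = 0")
    case True
    then show ?thesis using UV by simp
  next
    case False
    then have "0 < sqrt U" using UV by simp
    moreover have "sqrt U * sqrt U \<le> 8 * K * sqrt V * sqrt U" using le UV by simp
    ultimately have "sqrt U \<le> 8 * K * sqrt V" by (simp only: mult_le_cancel_right_pos)
    then have "(sqrt U)\<^sup>2 \<le> (8 * K * sqrt V)\<^sup>2"
      by (rule power_mono) (use UV in auto)
    then show ?thesis using UV by (simp add: power_mult_distrib)
  qed
  then show ?thesis by (simp add: U_def V_def s_def K_def mult_ac)
qed

end

section \<open>Dyadic lattices and kernels\<close>

definition lattice_offset :: "(int \<Rightarrow> nat \<Rightarrow> real) \<Rightarrow> int \<Rightarrow> nat \<Rightarrow> real" where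
  "lattice_offset \<omega> k i = (\<Sum>\<^sub>\<infinity>j\<in>{..<k}. \<omega> j i * 2 powi j)"

text \<open>An infinite sum without summability defaults to 0, so this is what gives the offsets
  their meaning. Reindexing by \<open>k - 1 - n\<close> produces a geometric series.\<close>

lemma summable_powi_lessThan: "(\<lambda>j::int. (2::real) powi j) summable_on {..<k}"
proof -
  have "bij_betw (\<lambda>n. k - 1 - int n) UNIV {..<k}"
    by (rule bij_betwI[where g = "\<lambda>j. nat (k - 1 - j)"]) auto
  moreover have "(\<lambda>n. (2::real) powi (k - 1 - int n)) summable_on UNIV"
  proof -
    have "(\<lambda>n. (2::real) powi (k - 1 - int n)) = (\<lambda>n. 2 powi (k - 1) * (1 / 2) ^ n)"
      by (simp add: power_int_diff power_one_over)
    moreover have "summable (\<lambda>n. (2::real) powi (k - 1) * (1 / 2) ^ n)"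
      by (intro summable_mult summable_geometric) simp
    ultimately show ?thesis
      by (simp add: summable_on_UNIV_nonneg_real_iff)
  qed
  ultimately show ?thesis
    using summable_on_reindex_bij_betw[of "\<lambda>n. k - 1 - int n" UNIV "{..<k}" "\<lambda>j. (2::real) powi j"] by simp
qed

lemma lattice_offset_step:
  assumes "\<And>j i. \<omega> j i \<in> {0, 1}"
  shows "lattice_offset \<omega> (k + 1) i = lattice_offset \<omega> k i + \<omega> k i * 2 powi k"
proof -
  have "(\<lambda>j. \<omega> j i * 2 powi j) summable_on {..<k}"
  proof (rule summable_on_comparison_test[OF summable_powi_lessThan])
    fix j show "\<omega> j i * 2 powi j \<le> 2 powi j" "0 \<le> \<omega> j i * 2 powi j"
      using assms[of j i] by auto
  qed
  then have "(\<Sum>\<^sub>\<infinity>j\<in>insert k {..<k}. \<omega> j i * 2 powi j) = \<omega> k i * 2 powi k + lattice_offset \<omega> k i"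
    unfolding lattice_offset_def by (rule infsum_insert) simp
  moreover have "insert k {..<k} = {..<k + 1}" by auto
  ultimately show ?thesis by (simp add: lattice_offset_def)
qed

lemma translate_cube: "translate d t (cube d c s) = cube d (\<lambda>i. c i + t i) s"
proof (intro set_eqI iffI)
  fix x assume x: "x \<in> cube d (\<lambda>i. c i + t i) s"
  show "x \<in> translate d t (cube d c s)"
    unfolding translate_def
  proof (rule image_eqI)
    show "x = (\<lambda>i\<in>{..<d}. (\<lambda>i\<in>{..<d}. x i - t i) i + t i)"
      using x by (auto simp: cube_def PiE_def extensional_def fun_eq_iff)
    show "(\<lambda>i\<in>{..<d}. x i - t i) \<in> cube d c s"
      using x by (auto simp: cube_def PiE_def Pi_def)
  qed
next
  fix x assume "x \<in> translate d t (cube d c s)"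
  then obtain y where y: "y \<in> cube d c s" "x = (\<lambda>i\<in>{..<d}. y i + t i)"
    unfolding translate_def by blast
  show "x \<in> cube d (\<lambda>i. c i + t i) s"
    unfolding y(2) cube_def
  proof (rule PiE_I)
    fix i assume "i \<in> {..<d}"
    moreover from this have "y i \<in> {c i..<c i + s}" using y(1) unfolding cube_def by (rule PiE_mem[rotated])
    ultimately show "(\<lambda>i\<in>{..<d}. y i + t i) i \<in> {c i + t i..<c i + t i + s}" by simp
  qed simp
qed

section \<open>Nested grids of half-open cubes\<close>

text \<open>A lattice is reduced to one offset vector per generation. The relation
  \<open>t_step\<close> between consecutive offsets, a binary digit times the side length, is what
  makes the cubes nest.\<close>

locale grid =
  fixes d :: nat and t :: "int \<Rightarrow> nat \<Rightarrow> real"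
  assumes d: "1 \<le> d"
    and t_step: "t (k + 1) i = t k i \<or> t (k + 1) i = t k i + 2 powi k"
begin

definition idx :: "int \<Rightarrow> point \<Rightarrow> nat \<Rightarrow> int" where
  "idx k x i = \<lfloor>(x i - t k i) / 2 powi k\<rfloor>"

text \<open>Equality of indices makes the partition properties immediate. Only the coordinates of
  \<open>x\<close> below \<open>d\<close> enter, so this is a genuine cube even for \<open>x\<close>
  outside \<open>Rd d\<close>.\<close>

definition Cell :: "int \<Rightarrow> point \<Rightarrow> point set" where
  "Cell k x = {y \<in> Rd d. \<forall>i<d. idx k y i = idx k x i}"

definition grid_cubes :: "point set set" where
  "grid_cubes = {Cell k x | k x. x \<in> Rd d}"

lemma idx_eq_iff: "idx k x i = m \<longleftrightarrow> 2 powi k * m + t k i \<le> x i \<and> x i < 2 powi k * m + t k i + 2 powi k"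
proof -
  have p: "(0::real) < 2 powi k" by simp
  have "idx k x i = m \<longleftrightarrow> m \<le> (x i - t k i) / 2 powi k \<and> (x i - t k i) / 2 powi k < m + 1"
    by (auto simp: idx_def floor_eq_iff)
  also have "\<dots> \<longleftrightarrow> m * 2 powi k \<le> x i - t k i \<and> x i - t k i < (m + 1) * 2 powi k"
    using p by (simp only: pos_le_divide_eq pos_divide_less_eq)
  finally show ?thesis by (auto simp: algebra_simps)
qed

lemma Cell_cube: "Cell k x = cube d (\<lambda>i. 2 powi k * idx k x i + t k i) (2 powi k)"
  by (auto simp: Cell_def cube_def idx_eq_iff PiE_def Pi_def)

lemma cube_Cell:
  fixes m :: "nat \<Rightarrow> int"
  shows "\<exists>x\<in>Rd d. cube d (\<lambda>i. 2 powi k * m i + t k i) (2 powi k) = Cell k x"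
proof
  let ?x = "\<lambda>i\<in>{..<d}. 2 powi k * m i + t k i"
  show "?x \<in> Rd d" by auto
  have "idx k ?x i = m i" if "i < d" for i using that by (simp add: idx_eq_iff)
  then show "cube d (\<lambda>i. 2 powi k * m i + t k i) (2 powi k) = Cell k ?x"
    unfolding Cell_cube cube_def by (intro PiE_cong) auto
qed

lemma Cell_subset_Rd: "Cell k x \<subseteq> Rd d"
  by (auto simp: Cell_def)

lemma self_in_Cell: "x \<in> Rd d \<Longrightarrow> x \<in> Cell k x"
  by (simp add: Cell_def)

lemma Cell_eq: "y \<in> Cell k x \<Longrightarrow> Cell k y = Cell k x"
  by (simp add: Cell_def)

text \<open>The index at generation \<open>k + 1\<close> is a function of the index at generation
  \<open>k\<close>: subtract the digit \<open>e\<close> and halve, rounding down.\<close>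

lemma Cell_step: "Cell k x \<subseteq> Cell (k + 1) x"
proof -
  have "idx (k + 1) y i = idx (k + 1) x i" if "idx k y i = idx k x i" for y i
  proof -
    obtain e :: int where e: "t (k + 1) i = t k i + e * 2 powi k" "e = 0 \<or> e = 1"
      using t_step[of k i] by (metis add.right_neutral mult_1 mult_zero_left of_int_0 of_int_1)
    have p2: "(2::real) powi (k + 1) = 2 powi k * 2" by (simp add: power_int_add)
    have *: "idx (k + 1) z i = (idx k z i - e) div 2" for z
    proof -
      have "idx (k + 1) z i = \<lfloor>((z i - t k i) / 2 powi k - of_int e) / real_of_int 2\<rfloor>"
        unfolding idx_def e(1) p2 by (simp add: field_simps)
      also have "\<dots> = \<lfloor>(z i - t k i) / 2 powi k - of_int e\<rfloor> div 2"
        by (rule floor_divide_real_eq_div) simp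
      finally show ?thesis by (simp add: idx_def)
    qed
    show ?thesis using that by (simp add: *)
  qed
  then show ?thesis unfolding Cell_def by blast
qed

lemma Cell_mono:
  assumes "k \<le> l"
  shows "Cell k x \<subseteq> Cell l x"
proof -
  have "Cell k x \<subseteq> Cell (k + int n) x" for n
  proof (induction n)
    case (Suc n)
    then show ?case using Cell_step[of "k + int n" x] by (auto simp: algebra_simps)
  qed simp
  from this[of "nat (l - k)"] show ?thesis using assms by simp
qed

lemma Cell_eq_mono: "y \<in> Cell k x \<Longrightarrow> k \<le> l \<Longrightarrow> Cell l y = Cell l x"
  using Cell_mono Cell_eq by blast

lemma side_length_Cell: "side_length d (Cell k x) = 2 powi k"
  unfolding Cell_cube using d by (rule side_length_cube) simp

lemma powi_2_inject: "(2::real) powi k = 2 powi l \<longleftrightarrow> k = l"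
  using power_int_strict_increasing[of k l "2::real"] power_int_strict_increasing[of l k "2::real"]
  by (metis less_irrefl linorder_neqE one_less_numeral_iff semiring_norm(76))

lemma Cell_level_inject: "Cell k x = Cell l y \<Longrightarrow> k = l"
  using side_length_Cell powi_2_inject by metis

text \<open>Side lengths determine generations, so a relative side length becomes a shift of the
  generation by \<open>m\<close>.\<close>

lemma subcubes_Cell:
  assumes "x \<in> Rd d"
  shows "subcubes d grid_cubes m (Cell k x) = Cell (k - int m) ` Cell k x"
proof (intro set_eqI iffI)
  fix R assume "R \<in> subcubes d grid_cubes m (Cell k x)"
  then obtain l y where R: "R = Cell l y" "y \<in> Rd d" "R \<subseteq> Cell k x"
      "side_length d R = 2 powi (- int m) * side_length d (Cell k x)"
    by (auto simp: subcubes_def grid_cubes_def)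
  then have "(2::real) powi l = 2 powi (- int m) * 2 powi k"
    by (simp add: side_length_Cell)
  also have "\<dots> = 2 powi (- int m + k)" by (rule power_int_add[symmetric]) simp
  finally have "l = k - int m" by (simp only: powi_2_inject)
  then show "R \<in> Cell (k - int m) ` Cell k x" using R self_in_Cell by blast
next
  fix R assume "R \<in> Cell (k - int m) ` Cell k x"
  then obtain y where y: "y \<in> Cell k x" "R = Cell (k - int m) y" by blast
  have "R \<subseteq> Cell k x" using Cell_mono[of "k - int m" k y] Cell_eq[OF y(1)] y by simp
  moreover have "R \<in> grid_cubes" using y Cell_subset_Rd[of k x] unfolding grid_cubes_def by blast
  moreover have "(2::real) powi (k - int m) = 2 powi (- int m) * 2 powi k"
    by (simp add: power_int_diff power_int_minus field_simps)
  ultimately show "R \<in> subcubes d grid_cubes m (Cell k x)"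
    by (simp add: subcubes_def side_length_Cell y(2))
qed

text \<open>A cell is determined by its index vector, and the index vectors of points in a bounded
  cube lie in a finite box.\<close>

lemma finite_Cells: "finite (Cell (k - int m) ` Cell k x)"
proof -
  let ?l = "k - int m"
  let ?c = "\<lambda>i. 2 powi k * idx k x i + t k i"
  let ?F = "\<Pi>\<^sub>E i\<in>{..<d}. {\<lfloor>(?c i - t ?l i) / 2 powi ?l\<rfloor>..\<lfloor>(?c i + 2 powi k - t ?l i) / 2 powi ?l\<rfloor>}"
  have "(\<lambda>y. restrict (idx ?l y) {..<d}) ` Cell k x \<subseteq> ?F"
  proof (intro image_subsetI)
    fix y assume y: "y \<in> Cell k x"
    show "restrict (idx ?l y) {..<d} \<in> ?F"
    proof (rule restrict_PiE_iff[THEN iffD2], intro ballI)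
      fix i assume "i \<in> {..<d}"
      then have "idx k y i = idx k x i" using y by (simp add: Cell_def)
      then have c: "?c i \<le> y i" "y i \<le> ?c i + 2 powi k" using idx_eq_iff[of k y i] by auto
      show "idx ?l y i \<in> {\<lfloor>(?c i - t ?l i) / 2 powi ?l\<rfloor>..\<lfloor>(?c i + 2 powi k - t ?l i) / 2 powi ?l\<rfloor>}"
        unfolding idx_def atLeastAtMost_iff
        by (intro conjI floor_mono divide_right_mono diff_right_mono) (use c in \<open>auto simp: idx_def\<close>)
    qed
  qed
  then have fin: "finite ((\<lambda>y. restrict (idx ?l y) {..<d}) ` Cell k x)"
    by (rule finite_subset) (auto intro!: finite_PiE)
  have "Cell ?l y = {z \<in> Rd d. \<forall>i<d. idx ?l z i = restrict (idx ?l y) {..<d} i}" for y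
    by (simp add: Cell_def)
  then have "Cell ?l ` Cell k x =
      (\<lambda>u. {z \<in> Rd d. \<forall>i<d. idx ?l z i = u i}) ` ((\<lambda>y. restrict (idx ?l y) {..<d}) ` Cell k x)"
    unfolding image_image by simp
  then show ?thesis using fin by simp
qed

lemma cube_measure:
  assumes "0 \<le> s"
  shows "cube d c s \<in> sets (Leb d)" "emeasure (Leb d) (cube d c s) = ennreal (s ^ d)"
proof -
  interpret product_sigma_finite "\<lambda>_::nat. lborel :: real measure" ..
  have s: "cube d c s \<in> sets (Pi\<^sub>M {..<d} (\<lambda>_. lborel))"
    unfolding cube_def by (intro sets_PiM_I_finite) auto
  then show "cube d c s \<in> sets (Leb d)" unfolding Leb_def by simp
  have "emeasure (Pi\<^sub>M {..<d} (\<lambda>_. lborel)) (cube d c s) = (\<Prod>i<d. emeasure lborel {c i..<c i + s})"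
    unfolding cube_def by (intro emeasure_PiM) auto
  also have "\<dots> = ennreal (s ^ d)"
    using assms by (simp add: ennreal_power)
  finally show "emeasure (Leb d) (cube d c s) = ennreal (s ^ d)"
    unfolding Leb_def using s by simp
qed

lemma Cell_sets [measurable]: "Cell k x \<in> sets (Leb d)"
  unfolding Cell_cube by (rule cube_measure) simp

lemma emeasure_Cell: "emeasure (Leb d) (Cell k x) = ennreal ((2 powi k) ^ d)"
  unfolding Cell_cube by (rule cube_measure) simp

lemma measure_Cell: "measure (Leb d) (Cell k x) = (2 powi k) ^ d"
  by (simp add: measure_def emeasure_Cell)

section \<open>Haar functions and shift kernels on a grid\<close>

text \<open>\<open>sup_norm\<close> is a real supremum and needs a bounded set; a generalized Haar
  function takes at most one value per child, besides 0.\<close>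

lemma generalized_haar_norm_le:
  assumes "generalized_haar d grid_cubes (Cell k z) h" "z \<in> Rd d" "x \<in> Rd d"
  shows "norm (h x) \<le> sup_norm d h"
proof -
  have ch: "subcubes d grid_cubes 1 (Cell k z) = Cell (k - 1) ` Cell k z"
    using subcubes_Cell[OF assms(2), of 1 k] by simp
  have "h ` Rd d \<subseteq> insert 0 (\<Union>R\<in>Cell (k - 1) ` Cell k z. h ` R)"
  proof (intro image_subsetI)
    fix y assume y: "y \<in> Rd d"
    show "h y \<in> insert 0 (\<Union>R\<in>Cell (k - 1) ` Cell k z. h ` R)"
      using assms(1) y self_in_Cell[OF y, of "k - 1"] by (cases "y \<in> Cell k z") (auto simp: generalized_haar_def)
  qed
  moreover have "finite (h ` R)" if "R \<in> Cell (k - 1) ` Cell k z" for R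
  proof -
    have "h constant_on R" using assms(1) that ch by (auto simp: generalized_haar_def)
    then obtain e where "\<forall>x\<in>R. h x = e" by (auto simp: constant_on_def)
    then have "h ` R \<subseteq> {e}" by auto
    then show ?thesis by (rule finite_subset) simp
  qed
  then have "finite (insert 0 (\<Union>R\<in>Cell (k - 1) ` Cell k z. h ` R))"
    using finite_Cells[of k 1 z] by (simp del: UN_simps)
  ultimately have "finite (h ` Rd d)" by (rule finite_subset)
  then have "finite ((\<lambda>x. norm (h x)) ` Rd d)" by (metis finite_imageI image_image)
  then show ?thesis unfolding sup_norm_def using assms(3) by (intro cSUP_upper) (auto intro: bdd_above_finite)
qed

lemma generalized_haar_const:
  assumes "generalized_haar d grid_cubes (Cell k z) h" "z \<in> Rd d" "x \<in> Cell k z" "x' \<in> Cell (k - 1) x"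
  shows "h x' = h x"
proof -
  have "h constant_on Cell (k - 1) x"
    using assms(1) assms(3) subcubes_Cell[OF assms(2), of 1 k] by (auto simp: generalized_haar_def)
  moreover have "x \<in> Cell (k - 1) x" using self_in_Cell assms(3) Cell_subset_Rd by blast
  ultimately show ?thesis using assms(4) by (auto simp: constant_on_def)
qed

text \<open>At a given pair of points at most one term of the double sum survives, because subcubes
  of one generation are disjoint. Size and constancy of the kernel thus reduce to those of a single
  product of Haar functions.\<close>

lemma shift_kernel_props:
  assumes ker: "shift_kernel (generalized_haar d grid_cubes) d grid_cubes m n a" and z: "z \<in> Rd d"
  shows "\<lbrakk>x \<in> Rd d; y \<in> Rd d; x \<notin> Cell k z \<or> y \<notin> Cell k z\<rbrakk> \<Longrightarrow> a (Cell k z) x y = 0"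
    and "\<lbrakk>x \<in> Rd d; y \<in> Rd d\<rbrakk> \<Longrightarrow> norm (a (Cell k z) x y) \<le> 1 / measure (Leb d) (Cell k z)"
    and "\<lbrakk>x \<in> Rd d; y \<in> Rd d; x' \<in> Cell l x; y' \<in> Cell l y; l + int (max m n) < k\<rbrakk>
           \<Longrightarrow> a (Cell k z) x' y' = a (Cell k z) x y"
proof -
  let ?Q = "Cell k z"
  let ?S = "\<lambda>m. Cell (k - int m) ` ?Q"
  obtain u v where uv:
    "\<forall>Q\<in>grid_cubes. \<forall>Q'\<in>subcubes d grid_cubes m Q. \<forall>Q''\<in>subcubes d grid_cubes n Q.
       generalized_haar d grid_cubes Q'' (u Q' Q'') \<and> generalized_haar d grid_cubes Q' (v Q' Q'') \<and>
       sup_norm d (v Q' Q'') * sup_norm d (u Q' Q'') \<le> 1"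
    "\<forall>Q\<in>grid_cubes. \<forall>x\<in>Rd d. \<forall>y\<in>Rd d.
       a Q x y = complex_of_real (1 / measure (Leb d) Q) *
             (\<Sum>Q'\<in>subcubes d grid_cubes m Q. \<Sum>Q''\<in>subcubes d grid_cubes n Q. u Q' Q'' x * v Q' Q'' y)"
    using ker unfolding shift_kernel_def by (elim exE conjE) (rule that)
  have Q: "?Q \<in> grid_cubes" using z unfolding grid_cubes_def by blast
  have hu: "generalized_haar d grid_cubes Q'' (u Q' Q'')"
    and hv: "generalized_haar d grid_cubes Q' (v Q' Q'')"
    and le1: "sup_norm d (v Q' Q'') * sup_norm d (u Q' Q'') \<le> 1"
    if "Q' \<in> ?S m" "Q'' \<in> ?S n" for Q' Q''
    using uv(1)[rule_format, OF Q, of Q' Q''] that unfolding subcubes_Cell[OF z] by blast+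
  have a: "a ?Q x y = complex_of_real (1 / measure (Leb d) ?Q) *
             (\<Sum>Q'\<in>?S m. \<Sum>Q''\<in>?S n. u Q' Q'' x * v Q' Q'' y)" if "x \<in> Rd d" "y \<in> Rd d" for x y
    using uv(2)[rule_format, OF Q that] unfolding subcubes_Cell[OF z] .
  have sub: "R \<subseteq> ?Q" if R: "R \<in> ?S j" for R j
  proof -
    obtain y where "y \<in> ?Q" "R = Cell (k - int j) y" using R by blast
    then show ?thesis using Cell_mono[of "k - int j" k y] Cell_eq[of y k z] by simp
  qed
  have u0: "u Q' Q'' x = 0" if "Q' \<in> ?S m" "Q'' \<in> ?S n" "x \<in> Rd d" "x \<notin> Q''" for Q' Q'' x
    using hu[OF that(1,2)] that by (auto simp: generalized_haar_def)
  have v0: "v Q' Q'' x = 0" if "Q' \<in> ?S m" "Q'' \<in> ?S n" "x \<in> Rd d" "x \<notin> Q'" for Q' Q'' x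
    using hv[OF that(1,2)] that by (auto simp: generalized_haar_def)
  show out: "a ?Q x y = 0" if "x \<in> Rd d" "y \<in> Rd d" "x \<notin> ?Q \<or> y \<notin> ?Q" for x y
  proof -
    have "(\<Sum>Q'\<in>?S m. \<Sum>Q''\<in>?S n. u Q' Q'' x * v Q' Q'' y) = 0"
    proof (intro sum.neutral ballI)
      fix Q' Q'' assume *: "Q' \<in> ?S m" "Q'' \<in> ?S n"
      then have "x \<notin> Q'' \<or> y \<notin> Q'" using sub[OF *(1)] sub[OF *(2)] that(3) by blast
      then show "u Q' Q'' x * v Q' Q'' y = 0" using u0[OF *] v0[OF *] that by auto
    qed
    then show ?thesis using a that by simp
  qed
  \<comment> \<open>The surviving pair: \<open>u\<close> lives on the subcube containing
    \<open>x\<close>, and \<open>v\<close> on the one containing \<open>y\<close>.\<close>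
  have single: "a ?Q x y = complex_of_real (1 / measure (Leb d) ?Q) *
      (u (Cell (k - int m) y) (Cell (k - int n) x) x * v (Cell (k - int m) y) (Cell (k - int n) x) y)"
    if x: "x \<in> ?Q" and y: "y \<in> ?Q" for x y
  proof -
    let ?Q' = "Cell (k - int m) y" and ?Q'' = "Cell (k - int n) x"
    have Rd: "x \<in> Rd d" "y \<in> Rd d" using x y Cell_subset_Rd by blast+
    have mem: "?Q' \<in> ?S m" "?Q'' \<in> ?S n" using x y by auto
    have "(\<Sum>Q''\<in>?S n. u Q' Q'' x * v Q' Q'' y) = 0" if "Q' \<in> ?S m - {?Q'}" for Q'
    proof (rule sum.neutral, intro ballI)
      fix Q'' assume "Q'' \<in> ?S n"
      moreover have "y \<notin> Q'" using that Cell_eq by auto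
      ultimately show "u Q' Q'' x * v Q' Q'' y = 0" using v0 that Rd by simp
    qed
    then have "(\<Sum>Q'\<in>?S m. \<Sum>Q''\<in>?S n. u Q' Q'' x * v Q' Q'' y) = (\<Sum>Q''\<in>?S n. u ?Q' Q'' x * v ?Q' Q'' y)"
      using mem finite_Cells by (subst sum.remove[of _ ?Q']) auto
    also have "\<dots> = u ?Q' ?Q'' x * v ?Q' ?Q'' y"
    proof -
      have "u ?Q' Q'' x * v ?Q' Q'' y = 0" if "Q'' \<in> ?S n - {?Q''}" for Q''
      proof -
        have "x \<notin> Q''" using that Cell_eq by auto
        then show ?thesis using u0[OF mem(1), of Q'' x] that Rd by simp
      qed
      then have "(\<Sum>Q''\<in>?S n - {?Q''}. u ?Q' Q'' x * v ?Q' Q'' y) = 0"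
        by (intro sum.neutral ballI)
      then show ?thesis by (simp only: sum.remove[OF finite_Cells mem(2)] add_0_right)
    qed
    finally show ?thesis using a[OF Rd] by simp
  qed
  show "norm (a ?Q x y) \<le> 1 / measure (Leb d) ?Q" if Rd: "x \<in> Rd d" "y \<in> Rd d" for x y
  proof (cases "x \<in> ?Q \<and> y \<in> ?Q")
    case True
    let ?Q' = "Cell (k - int m) y" and ?Q'' = "Cell (k - int n) x"
    have mem: "?Q' \<in> ?S m" "?Q'' \<in> ?S n" using True by auto
    have "norm (u ?Q' ?Q'' x * v ?Q' ?Q'' y) \<le> sup_norm d (u ?Q' ?Q'') * sup_norm d (v ?Q' ?Q'')"
      unfolding norm_mult
      using generalized_haar_norm_le[OF hu[OF mem] Rd(1) Rd(1)] generalized_haar_norm_le[OF hv[OF mem] Rd(2) Rd(2)]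
      by (intro mult_mono) (auto intro: order_trans[OF norm_ge_zero])
    also have "\<dots> \<le> 1" using le1[OF mem] by (simp add: mult.commute)
    finally have "norm (u ?Q' ?Q'' x * v ?Q' ?Q'' y) \<le> 1" .
    then have "1 / measure (Leb d) ?Q * norm (u ?Q' ?Q'' x * v ?Q' ?Q'' y) \<le> 1 / measure (Leb d) ?Q * 1"
      by (intro mult_left_mono) auto
    then show ?thesis using single[of x y] True by (simp add: norm_mult norm_divide)
  next
    case False
    then show ?thesis using out[OF Rd] by auto
  qed
  show "a ?Q x' y' = a ?Q x y"
    if Rd: "x \<in> Rd d" "y \<in> Rd d" and x': "x' \<in> Cell l x" and y': "y' \<in> Cell l y" and l: "l + int (max m n) < k"
    for x y x' y'
  proof -
    have Rd': "x' \<in> Rd d" "y' \<in> Rd d" using x' y' Cell_subset_Rd by blast+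
    have iff: "w' \<in> ?Q \<longleftrightarrow> w \<in> ?Q" if "w' \<in> Cell l w" "w \<in> Rd d" "w' \<in> Rd d" for w w'
    proof -
      have "Cell k w' = Cell k w" using l by (intro Cell_eq_mono[OF that(1)]) simp
      then show ?thesis
        using self_in_Cell[OF that(2), of k] self_in_Cell[OF that(3), of k] Cell_eq by blast
    qed
    show ?thesis
    proof (cases "x \<in> ?Q \<and> y \<in> ?Q")
      case True
      let ?Q' = "Cell (k - int m) y" and ?Q'' = "Cell (k - int n) x"
      have T': "x' \<in> ?Q \<and> y' \<in> ?Q" using True iff[OF x' Rd(1) Rd'(1)] iff[OF y' Rd(2) Rd'(2)] by blast
      have mem: "?Q' \<in> ?S m" "?Q'' \<in> ?S n" using True by auto
      have eq: "Cell (k - int m) y' = ?Q'" "Cell (k - int n) x' = ?Q''"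
        using Cell_eq_mono[OF x'] Cell_eq_mono[OF y'] l by auto
      \<comment> \<open>Haar functions are constant on children, one generation below the subcubes;
        this is why the hypothesis on \<open>l\<close> is a strict inequality.\<close>
      have l': "l \<le> k - int n - 1" "l \<le> k - int m - 1" using l by linarith+
      have "x' \<in> Cell (k - int n - 1) x" "y' \<in> Cell (k - int m - 1) y"
        using Cell_mono[OF l'(1), of x] Cell_mono[OF l'(2), of y] x' y' by auto
      then have "u ?Q' ?Q'' x' = u ?Q' ?Q'' x" "v ?Q' ?Q'' y' = v ?Q' ?Q'' y"
        using generalized_haar_const[OF hu[OF mem] Rd(1) self_in_Cell[OF Rd(1)]]
          generalized_haar_const[OF hv[OF mem] Rd(2) self_in_Cell[OF Rd(2)]] by auto
      then show ?thesis using single[of x y] single[of x' y'] True T' eq by simp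
    next
      case False
      then show ?thesis
        using out[OF Rd] out[OF Rd'] iff[OF x' Rd(1) Rd'(1)] iff[OF y' Rd(2) Rd'(2)] by auto
    qed
  qed
qed

end

text \<open>The side length condition forces a cube and its translation to have the same generation,
  so the lattice consists of the cells of the grid with offsets
  \<open>lattice_offset \<omega>\<close>.\<close>

lemma dyadic_lattice_grid:
  assumes "1 \<le> d" "dyadic_lattice d D"
  obtains t where "grid d t" "D = grid.grid_cubes d t"
proof -
  obtain \<omega> :: "int \<Rightarrow> nat \<Rightarrow> real" where \<omega>: "\<And>j i. \<omega> j i \<in> {0, 1}"
    and D: "D = {translate d (lattice_offset \<omega> k) I | I k. I \<in> std_dyadic d \<and> side_length d I = 2 powi k}"
    using assms(2) unfolding dyadic_lattice_def lattice_offset_def by blast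
  interpret grid d "lattice_offset \<omega>"
  proof
    show "lattice_offset \<omega> (k + 1) i = lattice_offset \<omega> k i \<or>
      lattice_offset \<omega> (k + 1) i = lattice_offset \<omega> k i + 2 powi k" for k i
      using lattice_offset_step[of \<omega> k i, OF \<omega>] \<omega>[of k i] by auto
  qed (rule assms(1))
  have "D = {cube d (\<lambda>i. 2 powi k * real_of_int (m i) + lattice_offset \<omega> k i) (2 powi k) | (k::int) (m::nat \<Rightarrow> int). True}"
    (is "_ = ?E")
  proof (intro set_eqI iffI)
    fix Q assume "Q \<in> D"
    then obtain k l and m :: "nat \<Rightarrow> int" where
      Q: "Q = translate d (lattice_offset \<omega> k) (cube d (\<lambda>i. 2 powi l * real_of_int (m i)) (2 powi l))"
      and "side_length d (cube d (\<lambda>i. 2 powi l * real_of_int (m i)) (2 powi l)) = 2 powi k"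
      by (auto simp: D std_dyadic_def)
    then have "l = k" using side_length_cube[OF assms(1)] by (simp add: powi_2_inject)
    then show "Q \<in> ?E" using Q by (auto simp: translate_cube)
  next
    fix Q assume "Q \<in> ?E"
    then obtain k and m :: "nat \<Rightarrow> int" where
      "Q = translate d (lattice_offset \<omega> k) (cube d (\<lambda>i. 2 powi k * real_of_int (m i)) (2 powi k))"
      by (auto simp: translate_cube)
    moreover have "side_length d (cube d (\<lambda>i. 2 powi k * real_of_int (m i)) (2 powi k)) = 2 powi k"
      by (rule side_length_cube[OF assms(1)]) simp
    ultimately show "Q \<in> D" unfolding D std_dyadic_def by blast
  qed
  also have "\<dots> = grid_cubes"
  proof (intro set_eqI iffI)
    fix Q assume "Q \<in> ?E"
    then obtain k and m :: "nat \<Rightarrow> int" where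
      "Q = cube d (\<lambda>i. 2 powi k * real_of_int (m i) + lattice_offset \<omega> k i) (2 powi k)" by blast
    with cube_Cell[of k m] show "Q \<in> grid_cubes" unfolding grid_cubes_def by auto
  next
    fix Q assume "Q \<in> grid_cubes"
    then obtain k x where "Q = Cell k x" unfolding grid_cubes_def by blast
    then show "Q \<in> ?E" unfolding Cell_cube by blast
  qed
  finally show ?thesis by (rule that[OF grid_axioms])
qed

section \<open>Discretization\<close>

text \<open>Pointwise, 2 |f| \<le> l |f|^2 w + 1 / (l w) for every \<open>l > 0\<close>. The choice
  \<open>l = 1\<close> gives integrability, and the best \<open>l\<close> gives the
  inequality.\<close>

lemma weighted_Cauchy_Schwarz:
  fixes f :: "'a \<Rightarrow> complex" and w :: "'a \<Rightarrow> real"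
  assumes [measurable]: "A \<in> sets M" "f \<in> borel_measurable M" "w \<in> borel_measurable M"
    and pos: "AE x in M. 0 < w x"
    and fw: "set_integrable M A (\<lambda>x. (norm (f x))\<^sup>2 * w x)"
    and w: "set_integrable M A (\<lambda>x. inverse (w x))"
  shows "set_integrable M A f"
    and "(LINT x:A|M. norm (f x))\<^sup>2 \<le> (LINT x:A|M. (norm (f x))\<^sup>2 * w x) * (LINT x:A|M. inverse (w x))"
proof -
  have amgm: "2 * u \<le> l * (u\<^sup>2 * v) + inverse v / l" if "0 < v" "0 < l" for u v l :: real
  proof -
    have "0 \<le> (l * u * v - 1)\<^sup>2 / (l * v)" using that by simp
    also have "\<dots> = l * (u\<^sup>2 * v) + inverse v / l - 2 * u"
      using that by (simp add: field_simps power2_eq_square)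
    finally show ?thesis by simp
  qed
  have int: "set_integrable M A (\<lambda>x. l * ((norm (f x))\<^sup>2 * w x) + inverse (w x) / l)" for l
    using fw w by (intro set_integral_add set_integrable_mult_right set_integrable_divide) auto
  have "integrable M (\<lambda>x. indicator A x *\<^sub>R f x)"
  proof (rule Bochner_Integration.integrable_bound[OF int[of 1, unfolded set_integrable_def]])
    show "AE x in M. norm (indicator A x *\<^sub>R f x) \<le>
      norm (indicator A x *\<^sub>R (1 * ((norm (f x))\<^sup>2 * w x) + inverse (w x) / 1))"
      using pos
    proof eventually_elim
      case (elim x)
      have "norm (f x) \<le> (norm (f x))\<^sup>2 * w x + inverse (w x)"
        using amgm[OF elim, of 1 "norm (f x)"] norm_ge_zero[of "f x"]
        unfolding mult_1 div_by_1 by linarith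
      then show ?case by (auto simp: indicator_def)
    qed
  qed measurable
  then show f: "set_integrable M A f" by (simp add: set_integrable_def)
  define a where "a = (LINT x:A|M. norm (f x))"
  define b where "b = (LINT x:A|M. (norm (f x))\<^sup>2 * w x)"
  define c where "c = (LINT x:A|M. inverse (w x))"
  have le: "2 * a \<le> l * b + c / l" if l: "0 < l" for l
  proof -
    have "2 * a = (LINT x:A|M. 2 * norm (f x))" by (simp add: a_def)
    also have "\<dots> \<le> (LINT x:A|M. l * ((norm (f x))\<^sup>2 * w x) + inverse (w x) / l)"
    proof (rule set_integral_mono_AE)
      show "set_integrable M A (\<lambda>x. 2 * norm (f x))"
        using f by (intro set_integrable_mult_right set_integrable_norm) auto
      show "AE x\<in>A in M. 2 * norm (f x) \<le> l * ((norm (f x))\<^sup>2 * w x) + inverse (w x) / l"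
        using pos by eventually_elim (use amgm[OF _ l] in auto)
    qed (rule int)
    also have "\<dots> = l * b + c / l"
      unfolding b_def c_def using fw w by (subst set_integral_add) (auto intro!: set_integrable_mult_right set_integrable_divide)
    finally show ?thesis .
  qed
  have nn: "0 \<le> a" "0 \<le> b" "0 \<le> c"
  proof -
    show "0 \<le> a" by (simp add: a_def set_lebesgue_integral_def)
    show "0 \<le> b" unfolding b_def set_lebesgue_integral_def
      using pos by (intro integral_nonneg_AE) (auto elim!: eventually_mono)
    show "0 \<le> c" unfolding c_def set_lebesgue_integral_def
      using pos by (intro integral_nonneg_AE) (auto elim!: eventually_mono)
  qed
  have "a\<^sup>2 \<le> b * c"
  proof (cases "a = 0")
    case False
    then have a: "0 < a" using nn by simp
    show ?thesis
    proof (cases "c = 0")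
      case True
      \<comment> \<open>The optimal choice \<open>c / a\<close> is not positive here;
        \<open>a / (b + 1)\<close> contradicts \<open>0 < a\<close> instead.\<close>
      have "2 * a \<le> a / (b + 1) * b" using le[of "a / (b + 1)"] a nn True by simp
      also have "\<dots> \<le> a" using a nn by (simp add: field_simps)
      finally show ?thesis using a by simp
    next
      case False
      then have "2 * a \<le> c / a * b + a" using le[of "c / a"] a nn by simp
      then show ?thesis using a by (simp add: field_simps power2_eq_square)
    qed
  qed (use nn in simp)
  then show "(LINT x:A|M. norm (f x))\<^sup>2 \<le> (LINT x:A|M. (norm (f x))\<^sup>2 * w x) * (LINT x:A|M. inverse (w x))"
    by (simp add: a_def b_def c_def)
qed

text \<open>\<open>op_norm\<close> is an infimum, so the bound is first obtained with
  \<open>B + e\<close>, and then \<open>e\<close> tends to 0. Finiteness also puts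
  \<open>T A f\<close> into \<open>L2\<close>, since the infimum of the empty set is
  infinite.\<close>

lemma op_norm_SUP:
  assumes "(SUP A\<in>Pow D. op_norm d (T A)) = ereal B"
  shows "0 \<le> B"
    and "\<lbrakk>A \<subseteq> D; f \<in> L2 d (\<lambda>_. 1)\<rbrakk> \<Longrightarrow>
      T A f \<in> L2 d (\<lambda>_. 1) \<and> L2_norm d (\<lambda>_. 1) (T A f) \<le> B * L2_norm d (\<lambda>_. 1) f"
proof -
  have le: "op_norm d (T A) \<le> ereal B" if "A \<subseteq> D" for A
    unfolding assms[symmetric] using that by (intro SUP_upper) auto
  have "0 \<le> op_norm d (T {})" unfolding op_norm_def by (intro INF_greatest) auto
  then show "0 \<le> B" using le[of "{}"] by (metis empty_subsetI ereal_less_eq(5) order_trans)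
  assume A: "A \<subseteq> D" and f: "f \<in> L2 d (\<lambda>_. 1)"
  have K: "T A f \<in> L2 d (\<lambda>_. 1) \<and> L2_norm d (\<lambda>_. 1) (T A f) \<le> (B + e) * L2_norm d (\<lambda>_. 1) f" if "0 < e" for e
  proof -
    have "op_norm d (T A) < ereal (B + e)" using le[OF A] that by (simp add: le_less_trans)
    then obtain K where K: "0 \<le> K" "K < B + e" "T A f \<in> L2 d (\<lambda>_. 1)"
      "L2_norm d (\<lambda>_. 1) (T A f) \<le> K * L2_norm d (\<lambda>_. 1) f"
      using f unfolding op_norm_def by (auto simp: INF_less_iff)
    moreover have "K * L2_norm d (\<lambda>_. 1) f \<le> (B + e) * L2_norm d (\<lambda>_. 1) f"
      using K by (intro mult_right_mono) (auto simp: L2_norm_def)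
    ultimately show ?thesis by linarith
  qed
  have "((\<lambda>e. (B + e) * L2_norm d (\<lambda>_. 1) f) \<longlongrightarrow> (B + 0) * L2_norm d (\<lambda>_. 1) f) (at_right 0)"
    by (intro tendsto_intros)
  then have "L2_norm d (\<lambda>_. 1) (T A f) \<le> (B + 0) * L2_norm d (\<lambda>_. 1) f"
    by (rule tendsto_lowerbound) (auto simp: eventually_at_right_field K intro!: exI[of _ 1])
  then show "T A f \<in> L2 d (\<lambda>_. 1) \<and> L2_norm d (\<lambda>_. 1) (T A f) \<le> B * L2_norm d (\<lambda>_. 1) f"
    using K[of 1] by simp
qed

section \<open>The cells of a grid as a tree of corners\<close>

locale scaled_grid = grid +
  fixes N :: int
begin

definition corner :: "point \<Rightarrow> point" where
  "corner x = (\<lambda>i\<in>{..<d}. 2 powi N * idx N x i + t N i)"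

definition corners :: "point set" where
  "corners = corner ` Rd d"

definition vol :: real where
  "vol = (2 powi N) ^ d"

text \<open>
  Cubes of generation \<open>N\<close> are represented by their lower corners; on points that are not corners
  \<open>cell\<close> is trivial, so that the axioms of \<open>cell_tree\<close> hold without a carrier.
\<close>

definition cell :: "nat \<Rightarrow> point \<Rightarrow> point set" where
  "cell j p = (if p \<in> corners then corners \<inter> Cell (N + int j) p else {p})"

lemma vol_pos: "0 < vol"
  by (simp add: vol_def)

lemma corner_in_Cell: "corner x \<in> Cell N x"
proof -
  have "idx N (corner x) i = idx N x i" if "i < d" for i
    using that by (simp add: idx_eq_iff corner_def)
  moreover have "corner x \<in> Rd d" by (simp add: corner_def)
  ultimately show ?thesis unfolding Cell_def by blast
qed

lemma corner_eq: "y \<in> Cell N x \<Longrightarrow> corner y = corner x"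
  unfolding corner_def by (rule restrict_ext) (simp add: Cell_def)

lemma Cell_corner: "Cell N (corner x) = Cell N x"
  by (rule Cell_eq[OF corner_in_Cell])

lemma corner_corner: "p \<in> corners \<Longrightarrow> corner p = p"
  unfolding corners_def using corner_eq[OF corner_in_Cell] by (elim imageE) simp

lemma corner_Rd: "corner x \<in> Rd d"
  by (rule subsetD[OF Cell_subset_Rd corner_in_Cell])

lemma corners_Rd: "p \<in> corners \<Longrightarrow> p \<in> Rd d"
  unfolding corners_def by (elim imageE) (simp only: corner_Rd)

lemma mem_Cell_iff: "p \<in> corners \<Longrightarrow> x \<in> Rd d \<Longrightarrow> x \<in> Cell N p \<longleftrightarrow> corner x = p"
  by (metis Cell_corner corner_corner corner_eq self_in_Cell)

lemma corner_in_corners: "x \<in> Rd d \<Longrightarrow> corner x \<in> corners"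
  by (simp add: corners_def)

lemma Cell_corner_ge: "Cell (N + int j) (corner x) = Cell (N + int j) x"
  by (rule Cell_eq_mono[OF corner_in_Cell]) simp

lemma disjoint_Cells: "Y \<subseteq> corners \<Longrightarrow> disjoint_family_on (Cell N) Y"
proof (unfold disjoint_family_on_def, intro ballI impI equals0I)
  fix p q x assume Y: "Y \<subseteq> corners" "p \<in> Y" "q \<in> Y" "p \<noteq> q" and x: "x \<in> Cell N p \<inter> Cell N q"
  then have "x \<in> Rd d" using Cell_subset_Rd by blast
  then have "corner x = p" "corner x = q" using mem_Cell_iff[of _ x] Y x by blast+
  then show False using Y by simp
qed

lemma finite_cell: "finite (cell j p)"
proof -
  have "finite (corners \<inter> Cell (N + int j) p)"
  proof (rule finite_imageD)
    have "Cell N ` (corners \<inter> Cell (N + int j) p) \<subseteq> Cell ((N + int j) - int j) ` Cell (N + int j) p" by auto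
    then show "finite (Cell N ` (corners \<inter> Cell (N + int j) p))" using finite_Cells by (rule finite_subset)
    show "inj_on (Cell N) (corners \<inter> Cell (N + int j) p)"
    proof (rule inj_onI)
      fix x y assume xy: "x \<in> corners \<inter> Cell (N + int j) p" "y \<in> corners \<inter> Cell (N + int j) p"
        and eq: "Cell N x = Cell N y"
      have "x \<in> Cell N y" using self_in_Cell[OF corners_Rd, of x N] xy eq by blast
      then show "x = y" using corner_eq[of x y] corner_corner xy by simp
    qed
  qed
  then show ?thesis by (simp add: cell_def)
qed

lemma cell_subset_corners: "p \<in> corners \<Longrightarrow> cell j p \<subseteq> corners"
  by (simp add: cell_def)

lemma mem_cell_Cell_eq: "q \<in> cell j p \<Longrightarrow> Cell (N + int j) q = Cell (N + int j) p"
  by (cases "p \<in> corners") (simp_all add: cell_def Cell_eq)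

lemma Cell_eq_UN: "p \<in> corners \<Longrightarrow> Cell (N + int j) p = (\<Union>q\<in>cell j p. Cell N q)"
proof (intro set_eqI iffI)
  fix x assume p: "p \<in> corners" and x: "x \<in> Cell (N + int j) p"
  then have xRd: "x \<in> Rd d" using Cell_subset_Rd by blast
  have "corner x \<in> Cell (N + int j) x" using corner_in_Cell Cell_mono[of N "N + int j" x] by auto
  then have "corner x \<in> cell j p" using p Cell_eq[OF x] corner_in_corners[OF xRd] by (simp add: cell_def)
  moreover have "x \<in> Cell N (corner x)" using self_in_Cell[OF xRd] Cell_corner by simp
  ultimately show "x \<in> (\<Union>q\<in>cell j p. Cell N q)" by blast
next
  fix x assume "p \<in> corners" "x \<in> (\<Union>q\<in>cell j p. Cell N q)"
  then obtain q where "q \<in> Cell (N + int j) p" "x \<in> Cell N q" by (auto simp: cell_def)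
  then show "x \<in> Cell (N + int j) p" using Cell_mono[of N "N + int j" q] Cell_eq by auto
qed

text \<open>Counting by volume: the cube is a disjoint union of cells of generation
  \<open>N\<close>, all of measure \<open>vol\<close>.\<close>

lemma card_cell: "p \<in> corners \<Longrightarrow> real (card (cell j p)) = (2 ^ d) ^ j"
proof -
  assume p: "p \<in> corners"
  have "measure (Leb d) (\<Union>q\<in>cell j p. Cell N q) = (\<Sum>q\<in>cell j p. measure (Leb d) (Cell N q))"
    by (rule measure_finite_Union)
      (use finite_cell disjoint_Cells[OF cell_subset_corners[OF p]] in \<open>auto simp: emeasure_Cell\<close>)
  then have "(2 powi (N + int j)) ^ d = card (cell j p) * vol"
    by (simp add: Cell_eq_UN[OF p, symmetric] measure_Cell vol_def)
  moreover have "(2 powi (N + int j)) ^ d = ((2::real) ^ d) ^ j * vol"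
    by (simp add: power_int_add power_mult_distrib vol_def mult.commute flip: power_mult)
  ultimately show ?thesis using vol_pos by simp
qed

sublocale cell_tree cell "2 ^ d"
proof
  show "cell 0 p = {p}" for p
  proof (cases "p \<in> corners")
    case True
    have "q = p" if "q \<in> corners" "q \<in> Cell N p" for q
      using corner_eq[OF that(2)] corner_corner that(1) True by simp
    then have "corners \<inter> Cell N p = {p}" using True self_in_Cell[OF corners_Rd[OF True], of N] by blast
    then show ?thesis using True by (simp add: cell_def)
  qed (simp add: cell_def)
  show "finite (cell j p)" for j p by (rule finite_cell)
  show "cell j q = cell j p" if "q \<in> cell j p" for j p q
  proof (cases "p \<in> corners")
    case True
    then have "q \<in> corners" using that by (simp add: cell_def)
    then show ?thesis using True mem_cell_Cell_eq[OF that] by (simp add: cell_def)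
  qed (use that in \<open>simp add: cell_def\<close>)
  show "cell j p \<subseteq> cell (Suc j) p" for j p
    using Cell_mono[of "N + int j" "N + int (Suc j)" p] unfolding cell_def by auto
  show "real (card (cell (Suc j) p)) \<le> 2 ^ d * real (card (cell j p))" for j p
    by (cases "p \<in> corners") (simp_all add: card_cell, simp add: cell_def)
qed

lemma set_integral_Cell:
  fixes f :: "point \<Rightarrow> 'b::{banach, second_countable_topology}"
  assumes "p \<in> corners" "\<And>q. q \<in> cell j p \<Longrightarrow> set_integrable (Leb d) (Cell N q) f"
  shows "(LINT x:Cell (N + int j) p|Leb d. f x) = (\<Sum>q\<in>cell j p. LINT x:Cell N q|Leb d. f x)"
  unfolding Cell_eq_UN[OF assms(1)]
  by (rule set_integral_finite_Union)
    (use finite_cell disjoint_Cells[OF cell_subset_corners[OF assms(1)]] assms(2) in auto)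

lemma sum_indicator_Cell:
  assumes "finite Y" "Y \<subseteq> corners" "x \<in> Rd d"
  shows "(\<Sum>p\<in>Y. indicat_real (Cell N p) x *\<^sub>R (k p :: 'b::real_vector)) = (if corner x \<in> Y then k (corner x) else 0)"
proof -
  have "(\<Sum>p\<in>Y. indicat_real (Cell N p) x *\<^sub>R k p) = (\<Sum>p\<in>Y. if corner x = p then k p else 0)"
    using assms mem_Cell_iff[of _ x] by (intro sum.cong) (auto simp: indicator_def subset_iff)
  then show ?thesis using assms(1) by (simp add: sum.delta')
qed

text \<open>Passes between functions on corners and step functions of generation \<open>N\<close>.
  It serves with \<open>v\<close> equal to 1 for the unweighted bound and with \<open>v\<close>
  equal to \<open>w\<close> for the weighted one.\<close>

lemma step_function:
  fixes F s :: "point \<Rightarrow> complex" and v :: "point \<Rightarrow> real"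
  assumes Y: "finite Y" "Y \<subseteq> corners"
    and F: "\<And>x. x \<in> Rd d \<Longrightarrow> F x = (if corner x \<in> Y then s (corner x) else 0)"
    and v: "\<And>p. p \<in> Y \<Longrightarrow> set_integrable (Leb d) (Cell N p) v"
  shows "F \<in> borel_measurable (Leb d)"
    and "integrable (Leb d) (\<lambda>x. (norm (F x))\<^sup>2 * v x)"
    and "(LINT x|Leb d. (norm (F x))\<^sup>2 * v x) = (\<Sum>p\<in>Y. (norm (s p))\<^sup>2 * (LINT x:Cell N p|Leb d. v x))"
proof -
  have "(\<lambda>x. \<Sum>p\<in>Y. indicat_real (Cell N p) x *\<^sub>R s p) \<in> borel_measurable (Leb d)"
    by measurable
  then show "F \<in> borel_measurable (Leb d)"
    by (subst measurable_cong[where g = "\<lambda>x. \<Sum>p\<in>Y. indicat_real (Cell N p) x *\<^sub>R s p"])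
      (simp_all add: space_Leb F sum_indicator_Cell[OF Y])
  have eq: "(norm (F x))\<^sup>2 * v x = (\<Sum>p\<in>Y. (norm (s p))\<^sup>2 * (indicat_real (Cell N p) x *\<^sub>R v x))"
    if "x \<in> space (Leb d)" for x
  proof -
    have "(\<Sum>p\<in>Y. indicat_real (Cell N p) x *\<^sub>R ((norm (s p))\<^sup>2 * v x)) = (norm (F x))\<^sup>2 * v x"
      using that sum_indicator_Cell[OF Y, of x "\<lambda>p. (norm (s p))\<^sup>2 * v x"] F[of x] by (simp add: space_Leb)
    then show ?thesis by (simp add: mult_ac)
  qed
  have int: "integrable (Leb d) (\<lambda>x. (norm (s p))\<^sup>2 * (indicat_real (Cell N p) x *\<^sub>R v x))" if "p \<in> Y" for p
    using v[OF that] unfolding set_integrable_def by (rule integrable_mult_right)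
  show "integrable (Leb d) (\<lambda>x. (norm (F x))\<^sup>2 * v x)"
    by (subst Bochner_Integration.integrable_cong[OF refl eq], assumption)
      (intro Bochner_Integration.integrable_sum int)
  show "(LINT x|Leb d. (norm (F x))\<^sup>2 * v x) = (\<Sum>p\<in>Y. (norm (s p))\<^sup>2 * (LINT x:Cell N p|Leb d. v x))"
    unfolding set_lebesgue_integral_def
    by (subst Bochner_Integration.integral_cong[OF refl eq], assumption,
        subst Bochner_Integration.integral_sum[OF int], assumption)
      (simp only: Bochner_Integration.integral_mult_right_zero)
qed

definition mean :: "(point \<Rightarrow> 'b::{banach, second_countable_topology, real_normed_field}) \<Rightarrow> point \<Rightarrow> 'b" where
  "mean f p = (LINT x:Cell N p|Leb d. f x) / of_real vol"

end

section \<open>Finite shifts as operators on the tree\<close>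

text \<open>By \<open>fine\<close>, active cubes lie more than \<open>r\<close> generations above
  \<open>N\<close>, so \<open>const\<close> makes every active kernel constant on products of cells
  of generation \<open>N\<close>.\<close>

locale shift_grid = scaled_grid +
  fixes r :: nat and a :: "point set \<Rightarrow> point \<Rightarrow> point \<Rightarrow> complex"
  assumes support: "\<lbrakk>z \<in> Rd d; x \<in> Rd d; y \<in> Rd d; x \<notin> Cell k z \<or> y \<notin> Cell k z\<rbrakk> \<Longrightarrow> a (Cell k z) x y = 0"
    and norm_le: "\<lbrakk>z \<in> Rd d; x \<in> Rd d; y \<in> Rd d\<rbrakk> \<Longrightarrow> norm (a (Cell k z) x y) \<le> 1 / (2 powi k) ^ d"
    and const: "\<lbrakk>z \<in> Rd d; x \<in> Rd d; y \<in> Rd d; x' \<in> Cell l x; y' \<in> Cell l y; l + int r < k\<rbrakk>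
      \<Longrightarrow> a (Cell k z) x' y' = a (Cell k z) x y"
    and fine: "\<lbrakk>z \<in> Rd d; x \<in> Rd d; y \<in> Rd d; a (Cell k z) x y \<noteq> 0\<rbrakk> \<Longrightarrow> N + int r < k"
begin

text \<open>An integral over a cell of generation \<open>N\<close> is \<open>vol\<close> times a
  mean; the factor \<open>vol\<close> lets sums of \<open>ker\<close> against means reproduce the
  integral operator.\<close>

definition ker :: "nat \<Rightarrow> point \<Rightarrow> point \<Rightarrow> complex" where
  "ker j p q = (if p \<in> corners \<and> q \<in> cell j p then of_real vol * a (Cell (N + int j) p) p q else 0)"

text \<open>A cube consists of \<open>card (cell j p)\<close> cells of measure \<open>vol\<close>,
  so after scaling by \<open>vol\<close> a bound by one over the measure becomes one over the
  cardinality.\<close>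

lemma shift_ker: "shift_ker r ker"
  unfolding shift_ker_def
proof (intro conjI allI impI)
  fix j p q assume q: "q \<in> cell j p"
  show "norm (ker j p q) \<le> 1 / card (cell j p)"
  proof (cases "p \<in> corners")
    case True
    then have Rd: "p \<in> Rd d" "q \<in> Rd d" using q cell_subset_corners corners_Rd by blast+
    have "(2 powi (N + int j)) ^ d = card (cell j p) * vol"
      by (simp add: card_cell[OF True] power_int_add power_mult_distrib vol_def mult.commute flip: power_mult)
    then have "norm (a (Cell (N + int j) p) p q) \<le> 1 / (card (cell j p) * vol)"
      using norm_le[OF Rd(1) Rd, of "N + int j"] by simp
    then have "vol * norm (a (Cell (N + int j) p) p q) \<le> vol * (1 / (card (cell j p) * vol))"
      using vol_pos by (intro mult_left_mono) auto
    then show ?thesis using vol_pos q True by (simp add: ker_def norm_mult)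
  qed (simp add: ker_def)
next
  fix i j p p' q q' assume ij: "i + r < j" and p': "p' \<in> cell i p" and q': "q' \<in> cell i q"
  have c: "cell j p' = cell j p" "cell j q' = cell j q"
    using cell_eq_mono[OF p'] cell_eq_mono[OF q'] ij by auto
  have iff: "x' \<in> corners \<longleftrightarrow> x \<in> corners" if "x' \<in> cell i x" for x x'
    using that by (cases "x \<in> corners") (auto simp: cell_def)
  have memiff: "q' \<in> cell j p' \<longleftrightarrow> q \<in> cell j p"
    using c cell_sym self_in_cell by metis
  show "ker j p' q' = ker j p q"
  proof (cases "p \<in> corners \<and> q \<in> cell j p")
    case True
    then have pq: "p \<in> corners" "q \<in> corners" using cell_subset_corners by blast+
    then have "p' \<in> Cell (N + int i) p" "q' \<in> Cell (N + int i) q"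
      using p' q' by (auto simp: cell_def)
    moreover have "Cell (N + int j) p' = Cell (N + int j) p"
      using mem_cell_Cell_eq[of p' j p] cell_mono[of i j p] p' ij by auto
    ultimately have "a (Cell (N + int j) p') p' q' = a (Cell (N + int j) p) p q"
      using const[of p p q p' "N + int i" q' "N + int j"] corners_Rd pq ij by auto
    then show ?thesis using True memiff iff[OF p'] by (simp add: ker_def)
  next
    case False
    then show ?thesis using memiff iff[OF p'] by (auto simp: ker_def)
  qed
qed

text \<open>An active kernel at generation \<open>N\<close> would give \<open>N + int r < N\<close>
  by \<open>fine\<close>.\<close>

lemma ker_0: "ker 0 p q = 0"
proof (rule ccontr)
  assume "ker 0 p q \<noteq> 0"
  then have pq: "p \<in> corners" "q \<in> cell 0 p" and nz: "a (Cell (N + int 0) p) p q \<noteq> 0"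
    by (auto simp: ker_def split: if_splits)
  have "p \<in> Rd d" "q \<in> Rd d" using pq cell_subset_corners corners_Rd by blast+
  from fine[OF this(1) this nz] show False by simp
qed

text \<open>Discretization is exact: active kernels are constant on cells of generation
  \<open>N\<close>, so \<open>f\<close> enters only through its means. The cubes that contribute at
  \<open>x\<close> are those containing it, one for each generation.\<close>

lemma dyadic_shift_eq:
  assumes A: "A \<subseteq> grid_cubes"
    and top: "\<And>Q x y. \<lbrakk>Q \<in> A; x \<in> Rd d; y \<in> Rd d; a Q x y \<noteq> 0\<rbrakk> \<Longrightarrow> \<exists>j\<le>J. \<exists>z\<in>Rd d. Q = Cell (N + int j) z"
    and f: "\<And>p. p \<in> corners \<Longrightarrow> set_integrable (Leb d) (Cell N p) f"
    and x: "x \<in> Rd d" and p: "p = corner x"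
  shows "dyadic_shift d a A f x =
    (\<Sum>j\<in>{j. Cell (N + int j) p \<in> A \<and> j \<le> J}. \<Sum>q\<in>cell j p. ker j p q * mean f q)"
proof -
  define T where "T Q = (LINT y:Q|Leb d. a Q x y * f y)" for Q
  let ?I = "{j. Cell (N + int j) p \<in> A \<and> j \<le> J}"
  let ?c = "\<lambda>j. Cell (N + int j) p"
  have pc: "p \<in> corners" using x p by (simp add: corner_in_corners)
  have pRd: "p \<in> Rd d" using pc corners_Rd by blast
  have cx: "?c j = Cell (N + int j) x" for j unfolding p by (rule Cell_corner_ge)
  \<comment> \<open>If the kernel of \<open>Q\<close> were nonzero at some \<open>(x, y)\<close>,
    then \<open>support\<close> would put \<open>x\<close> in \<open>Q\<close>, and \<open>Q\<close>
    would belong to the chain of cubes over \<open>p\<close>.\<close>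
  have T0: "T Q = 0" if Q: "Q \<in> A" "Q \<notin> ?c ` ?I" for Q
  proof -
    have "a Q x y = 0" if y: "y \<in> Rd d" for y
    proof (rule ccontr)
      assume nz: "a Q x y \<noteq> 0"
      then obtain j z where jz: "j \<le> J" "z \<in> Rd d" "Q = Cell (N + int j) z"
        using top[OF Q(1) x y] by blast
      then have "x \<in> Q" using support[OF jz(2) x y] nz by blast
      then have "Q = ?c j" using Cell_eq jz cx by simp
      then show False using Q jz by blast
    qed
    moreover obtain k z where "Q = Cell k z" using Q(1) A unfolding grid_cubes_def by blast
    then have "Q \<subseteq> Rd d" using Cell_subset_Rd by blast
    ultimately have "indicat_real Q y *\<^sub>R (a Q x y * f y) = 0" for y
      by (cases "y \<in> Q") auto
    then show ?thesis by (simp only: T_def set_lebesgue_integral_def Bochner_Integration.integral_zero)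
  qed
  have T: "T (?c j) = (\<Sum>q\<in>cell j p. ker j p q * mean f q)" for j
  proof -
    \<comment> \<open>Beyond generation \<open>N + int r\<close> this is constancy; otherwise both
      values are 0 by \<open>fine\<close>.\<close>
    have eq: "a (?c j) x y = a (?c j) p q" if q: "q \<in> cell j p" and y: "y \<in> Cell N q" for q y
    proof -
      have Rd: "q \<in> Rd d" "y \<in> Rd d" using q y pc cell_subset_corners corners_Rd Cell_subset_Rd by blast+
      have xp: "x \<in> Cell N p" using mem_Cell_iff[OF pc x] p by simp
      show ?thesis
      proof (cases "N + int r < N + int j")
        case True
        then show ?thesis using const[OF pRd pRd Rd(1) xp y] by simp
      next
        case False
        then show ?thesis using fine[OF pRd x Rd(2), of "N + int j"] fine[OF pRd pRd Rd(1), of "N + int j"] by metis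
      qed
    qed
    have int: "set_integrable (Leb d) (Cell N q) (\<lambda>y. a (?c j) x y * f y)" if q: "q \<in> cell j p" for q
    proof -
      have "set_integrable (Leb d) (Cell N q) (\<lambda>y. a (?c j) p q * f y)"
        using f q pc cell_subset_corners by (intro set_integrable_mult_right) blast
      moreover have "set_integrable (Leb d) (Cell N q) (\<lambda>y. a (?c j) p q * f y)
          \<longleftrightarrow> set_integrable (Leb d) (Cell N q) (\<lambda>y. a (?c j) x y * f y)"
        by (rule set_integrable_cong) (use eq[OF q] in auto)
      ultimately show ?thesis by simp
    qed
    have "T (?c j) = (\<Sum>q\<in>cell j p. LINT y:Cell N q|Leb d. a (?c j) x y * f y)"
      unfolding T_def by (rule set_integral_Cell[OF pc int])
    also have "\<dots> = (\<Sum>q\<in>cell j p. LINT y:Cell N q|Leb d. a (?c j) p q * f y)"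
      by (intro sum.cong refl set_lebesgue_integral_cong) (use eq in auto)
    also have "\<dots> = (\<Sum>q\<in>cell j p. ker j p q * mean f q)"
      using pc vol_pos by (intro sum.cong refl) (simp add: ker_def mean_def)
    finally show ?thesis .
  qed
  have inj: "inj_on ?c ?I" by (rule inj_onI, drule Cell_level_inject) simp
  have "dyadic_shift d a A f x = (\<Sum>\<^sub>\<infinity>Q\<in>A. T Q)" by (simp add: dyadic_shift_def T_def)
  also have "\<dots> = (\<Sum>\<^sub>\<infinity>Q\<in>?c ` ?I. T Q)"
    by (rule infsum_cong_neutral) (use T0 in auto)
  also have "\<dots> = (\<Sum>Q\<in>?c ` ?I. T Q)" by (rule infsum_finite) simp
  also have "\<dots> = (\<Sum>j\<in>?I. T (?c j))" by (simp add: sum.reindex[OF inj])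
  finally show ?thesis by (simp add: T)
qed

text \<open>The restricted shift over the cells selected by \<open>G\<close> is tested on the step
  function with values \<open>h\<close>. Invariance of \<open>G\<close> on cells is what makes the
  selection a family of cubes.\<close>

lemma L2_transfer:
  assumes B: "0 \<le> B"
    and L2: "\<And>A f. \<lbrakk>A \<subseteq> grid_cubes; f \<in> L2 d (\<lambda>_. 1)\<rbrakk> \<Longrightarrow> dyadic_shift d a A f \<in> L2 d (\<lambda>_. 1) \<and>
       L2_norm d (\<lambda>_. 1) (dyadic_shift d a A f) \<le> B * L2_norm d (\<lambda>_. 1) f"
    and G: "\<And>j p q. q \<in> cell j p \<Longrightarrow> G j q = G j p"
  shows "(\<Sum>p\<in>cell J p0. (norm (\<Sum>j\<in>{j. G j p \<and> j \<le> J}. \<Sum>q\<in>cell j p. ker j p q * h q))\<^sup>2)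
         \<le> B\<^sup>2 * (\<Sum>p\<in>cell J p0. (norm (h p))\<^sup>2)"
proof (cases "p0 \<in> corners")
  case False
  then have "(\<Sum>p\<in>cell J p0. (norm (\<Sum>j\<in>{j. G j p \<and> j \<le> J}. \<Sum>q\<in>cell j p. ker j p q * h q))\<^sup>2) = 0"
    by (simp add: cell_def ker_def)
  then show ?thesis by (simp add: sum_nonneg)
next
  case True
  let ?Y = "cell J p0"
  have Y: "finite ?Y" "?Y \<subseteq> corners" using finite_cell cell_subset_corners True by blast+
  define S where "S p = (\<Sum>j\<in>{j. G j p \<and> j \<le> J}. \<Sum>q\<in>cell j p. ker j p q * h q)" for p
  define f where "f x = (if corner x \<in> ?Y then h (corner x) else 0)" for x
  define A where "A = {Cell (N + int j) p | j p. p \<in> ?Y \<and> j \<le> J \<and> G j p}"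
  have one: "set_integrable (Leb d) (Cell N p) (\<lambda>_. 1 :: real)" for p
    by (simp add: set_integrable_def emeasure_Cell)
  have one_int: "(LINT x:Cell N p|Leb d. 1) = vol" for p
    by (simp add: set_lebesgue_integral_def measure_Cell vol_def)
  note f_step = step_function[where F = f and s = h and v = "\<lambda>_. 1", OF Y f_def one]
  have fL2: "f \<in> L2 d (\<lambda>_. 1)" using f_step(1,2) by (simp add: L2_def)
  have f_cell: "f x = h q" if "q \<in> ?Y" "x \<in> Cell N q" for x q
    using that corner_eq[OF that(2)] corner_corner Y by (auto simp: f_def subset_iff)
  have f_cell0: "f x = 0" if "q \<in> corners - ?Y" "x \<in> Cell N q" for x q
    using that corner_eq[OF that(2)] corner_corner by (auto simp: f_def)
  have f_int: "set_integrable (Leb d) (Cell N q) f" if q: "q \<in> corners" for q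
  proof -
    have "set_integrable (Leb d) (Cell N q) (\<lambda>_. if q \<in> ?Y then h q else 0)"
      by (simp add: set_integrable_def emeasure_Cell)
    moreover have "set_integrable (Leb d) (Cell N q) (\<lambda>_. if q \<in> ?Y then h q else 0)
        \<longleftrightarrow> set_integrable (Leb d) (Cell N q) f"
      by (rule set_integrable_cong) (use f_cell f_cell0 q in auto)
    ultimately show ?thesis by simp
  qed
  have mean_f: "mean f q = h q" if "q \<in> ?Y" for q
  proof -
    have "(LINT x:Cell N q|Leb d. f x) = (LINT x:Cell N q|Leb d. h q)"
      by (rule set_lebesgue_integral_cong) (use f_cell[OF that] in auto)
    also have "\<dots> = of_real vol * h q"
      by (simp add: set_lebesgue_integral_def measure_Cell vol_def scaleR_conv_of_real emeasure_Cell)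
    finally show ?thesis using vol_pos by (simp add: mean_def)
  qed
  have A: "A \<subseteq> grid_cubes" using Y corners_Rd unfolding A_def grid_cubes_def by blast
  have A_iff: "Cell (N + int j) p \<in> A \<longleftrightarrow> G j p" if p: "p \<in> ?Y" and j: "j \<le> J" for j p
  proof
    assume "Cell (N + int j) p \<in> A"
    then obtain j' p' where jp: "Cell (N + int j) p = Cell (N + int j') p'" "p' \<in> ?Y" "G j' p'"
      unfolding A_def by blast
    then have "j' = j" using Cell_level_inject[OF jp(1)] by simp
    then have "p \<in> cell j p'" using jp p Y self_in_Cell[OF corners_Rd, of p "N + int j"] by (auto simp: cell_def)
    then show "G j p" using G jp \<open>j' = j\<close> by simp
  next
    assume "G j p"
    then show "Cell (N + int j) p \<in> A" unfolding A_def using that by blast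
  qed
  define g where "g = dyadic_shift d a A f"
  have g: "g x = S p" if x: "x \<in> Rd d" and p: "p = corner x" "p \<in> ?Y" for x p
  proof -
    have "g x = (\<Sum>j\<in>{j. Cell (N + int j) p \<in> A \<and> j \<le> J}. \<Sum>q\<in>cell j p. ker j p q * mean f q)"
      unfolding g_def
    proof (rule dyadic_shift_eq[OF A _ f_int x p(1)])
      fix Q assume "Q \<in> A"
      then show "\<exists>j\<le>J. \<exists>z\<in>Rd d. Q = Cell (N + int j) z"
        unfolding A_def using Y corners_Rd by blast
    qed
    also have "{j. Cell (N + int j) p \<in> A \<and> j \<le> J} = {j. G j p \<and> j \<le> J}"
      using A_iff[OF p(2)] by blast
    also have "(\<Sum>j\<in>{j. G j p \<and> j \<le> J}. \<Sum>q\<in>cell j p. ker j p q * mean f q) = S p"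
      unfolding S_def
    proof (intro sum.cong refl)
      fix j q assume "j \<in> {j. G j p \<and> j \<le> J}" "q \<in> cell j p"
      then have "q \<in> ?Y" using cell_mono[of j J p] cell_eq[OF p(2)] by auto
      then show "ker j p q * mean f q = ker j p q * h q" using mean_f by simp
    qed
    finally show ?thesis .
  qed
  \<comment> \<open>\<open>g1\<close> is \<open>g\<close> truncated to the top cell, so passing from
    \<open>g1\<close> to \<open>g\<close> can only increase the norm.\<close>
  define g1 where "g1 x = (if corner x \<in> ?Y then S (corner x) else 0)" for x
  note g_step = step_function[where F = g1 and s = S and v = "\<lambda>_. 1", OF Y g1_def one]
  have gL2: "g \<in> L2 d (\<lambda>_. 1)" "L2_norm d (\<lambda>_. 1) g \<le> B * L2_norm d (\<lambda>_. 1) f"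
    using L2[OF A fL2] by (auto simp: g_def)
  have "vol * (\<Sum>p\<in>?Y. (norm (S p))\<^sup>2) = (LINT x|Leb d. (norm (g1 x))\<^sup>2 * 1)"
    unfolding g_step(3) one_int by (simp add: sum_distrib_left mult.commute)
  also have "\<dots> \<le> (LINT x|Leb d. (norm (g x))\<^sup>2 * 1)"
    using g_step(2) gL2(1) g
    by (intro integral_mono) (auto simp: L2_def space_Leb g1_def)
  also have "\<dots> = (L2_norm d (\<lambda>_. 1) g)\<^sup>2"
    unfolding L2_norm_def by (subst real_sqrt_pow2) auto
  also have "\<dots> \<le> (B * L2_norm d (\<lambda>_. 1) f)\<^sup>2"
    using gL2(2) by (rule power_mono) (simp add: L2_norm_def)
  also have "\<dots> = B\<^sup>2 * (LINT x|Leb d. (norm (f x))\<^sup>2 * 1)"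
    unfolding L2_norm_def power_mult_distrib by (subst real_sqrt_pow2) auto
  also have "\<dots> = vol * (B\<^sup>2 * (\<Sum>p\<in>?Y. (norm (h p))\<^sup>2))"
    unfolding f_step(3) one_int by (simp add: sum_distrib_left mult_ac)
  finally show ?thesis using vol_pos by (simp add: S_def)
qed

text \<open>The tree estimate is applied to the means of \<open>f\<close>, \<open>w\<close> and
  \<open>inverse w\<close> over cells of generation \<open>N\<close>; step functions and
  Cauchy-Schwarz lead back to integrals.\<close>

lemma weighted_L2_bound:
  fixes B W :: real
  assumes B: "0 \<le> B"
    and L2: "\<And>A f. \<lbrakk>A \<subseteq> grid_cubes; f \<in> L2 d (\<lambda>_. 1)\<rbrakk> \<Longrightarrow> dyadic_shift d a A f \<in> L2 d (\<lambda>_. 1) \<and>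
       L2_norm d (\<lambda>_. 1) (dyadic_shift d a A f) \<le> B * L2_norm d (\<lambda>_. 1) f"
    and fin: "finite {Q \<in> grid_cubes. \<exists>x\<in>Rd d. \<exists>y\<in>Rd d. a Q x y \<noteq> 0}"
    and w: "weight d w"
    and W: "\<And>k x. (LINT y:Cell k x|Leb d. w y) * (LINT y:Cell k x|Leb d. inverse (w y)) \<le> W * ((2 powi k) ^ d)\<^sup>2"
    and f: "f \<in> L2 d w"
  shows "dyadic_shift d a grid_cubes f \<in> L2 d w"
    and "L2_norm d w (dyadic_shift d a grid_cubes f) \<le> 8 * (4 * 2 ^ d * B + 16 * r) * W * L2_norm d w f"
proof -
  have meas [measurable]: "w \<in> borel_measurable (Leb d)" "f \<in> borel_measurable (Leb d)"
    using w f by (auto simp: weight_def locally_integrable_def L2_def)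
  have w_pos: "AE x in Leb d. 0 < w x" using w by (simp add: weight_def)
  have w_int: "set_integrable (Leb d) (Cell k x) w" "set_integrable (Leb d) (Cell k x) (\<lambda>x. inverse (w x))" for k x
    using w unfolding Cell_cube weight_def locally_integrable_def by blast+
  have fw: "integrable (Leb d) (\<lambda>x. (norm (f x))\<^sup>2 * w x)" using f by (simp add: L2_def)
  have fw_int: "set_integrable (Leb d) A (\<lambda>x. (norm (f x))\<^sup>2 * w x)" if "A \<in> sets (Leb d)" for A
    unfolding set_integrable_def using that fw by (rule integrable_mult_indicator)
  have f_int: "set_integrable (Leb d) (Cell k x) f" for k x
    by (rule weighted_Cauchy_Schwarz(1)[OF _ _ _ w_pos]) (auto intro: fw_int w_int)
  define \<mu> where "\<mu> p = (LINT x:Cell N p|Leb d. w x)" for p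
  define \<nu> where "\<nu> p = (LINT x:Cell N p|Leb d. inverse (w x))" for p
  \<comment> \<open>Cauchy-Schwarz for the constant function 1. It yields both the positivity of
    \<mu> and \<nu> and the hypothesis \<open>one\<close> of the tree estimate.\<close>
  have \<mu>\<nu>: "vol\<^sup>2 \<le> \<mu> p * \<nu> p" for p
    using weighted_Cauchy_Schwarz(2)[where f = "\<lambda>_. 1" and A = "Cell N p", OF _ _ meas(1) w_pos] w_int
    by (simp add: \<mu>_def \<nu>_def vol_def measure_Cell emeasure_Cell set_lebesgue_integral_def)
  have \<mu>0: "0 \<le> \<mu> p" and \<nu>0: "0 \<le> \<nu> p" for p
    unfolding \<mu>_def \<nu>_def set_lebesgue_integral_def
    using w_pos by (auto intro!: integral_nonneg_AE elim!: eventually_mono)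
  have pos: "0 < \<mu> p" "0 < \<nu> p" for p
    using \<mu>\<nu>[of p] \<mu>0[of p] \<nu>0[of p] vol_pos by (auto simp: less_le not_le[symmetric])
  \<comment> \<open>The value 1 off the corners keeps the hypotheses of the tree estimate valid on
    trivial cells.\<close>
  define w' where "w' p = (if p \<in> corners then \<mu> p / vol else 1)" for p
  define \<sigma>' where "\<sigma>' p = (if p \<in> corners then \<nu> p / vol else 1)" for p
  have pos': "0 < w' p" "0 < \<sigma>' p" for p using pos vol_pos by (auto simp: w'_def \<sigma>'_def)
  have one: "1 \<le> \<sigma>' p * w' p" for p
    using \<mu>\<nu>[of p] vol_pos by (simp add: w'_def \<sigma>'_def field_simps power2_eq_square)
  have corner_A2: "sum w' (cell j p) * sum \<sigma>' (cell j p) \<le> W * (real (card (cell j p)))\<^sup>2" if p: "p \<in> corners" for j p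
  proof -
    have sub: "q \<in> corners" if "q \<in> cell j p" for q using that cell_subset_corners[OF p] by blast
    have w1: "sum w' (cell j p) = (LINT y:Cell (N + int j) p|Leb d. w y) / vol"
      by (simp add: set_integral_Cell[OF p w_int(1)] sum_divide_distrib w'_def \<mu>_def sub cong: sum.cong)
    have \<sigma>1: "sum \<sigma>' (cell j p) = (LINT y:Cell (N + int j) p|Leb d. inverse (w y)) / vol"
      by (simp add: set_integral_Cell[OF p w_int(2)] sum_divide_distrib \<sigma>'_def \<nu>_def sub cong: sum.cong)
    have "(2 powi (N + int j)) ^ d = card (cell j p) * vol"
      by (simp add: card_cell[OF p] power_int_add power_mult_distrib vol_def mult.commute flip: power_mult)
    with W[of "N + int j" p]
    have "(LINT y:Cell (N + int j) p|Leb d. w y) * (LINT y:Cell (N + int j) p|Leb d. inverse (w y))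
        \<le> W * (real (card (cell j p)))\<^sup>2 * (vol * vol)"
      by (simp add: power2_eq_square mult_ac)
    then show ?thesis
      unfolding w1 \<sigma>1 times_divide_times_eq using vol_pos by (simp only: pos_divide_le_eq mult_pos_pos)
  qed
  have "(\<lambda>i\<in>{..<d}. 0) \<in> Rd d" by simp
  then obtain p1 where p1: "p1 \<in> corners" using corner_in_corners by blast
  \<comment> \<open>On trivial cells both sums in the \<open>A2\<close> hypothesis are 1, so
    \<open>1 \<le> W\<close> is what is required there.\<close>
  have W1: "1 \<le> W"
    using corner_A2[OF p1, of 0] one[of p1] by (simp add: cell_0 mult.commute)
  have A2: "sum w' (cell j p) * sum \<sigma>' (cell j p) \<le> W * (real (card (cell j p)))\<^sup>2" for j p
    using corner_A2[of p j] W1 by (cases "p \<in> corners") (auto simp: cell_def w'_def \<sigma>'_def)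

  define Act where "Act = {Q \<in> grid_cubes. \<exists>x\<in>Rd d. \<exists>y\<in>Rd d. a Q x y \<noteq> 0}"
  have "\<forall>Q\<in>Act. \<exists>kz. snd kz \<in> Rd d \<and> Q = Cell (fst kz) (snd kz)"
    unfolding Act_def grid_cubes_def by auto
  then obtain kz where kz: "\<And>Q. Q \<in> Act \<Longrightarrow> snd (kz Q) \<in> Rd d \<and> Q = Cell (fst (kz Q)) (snd (kz Q))"
    by metis
  \<comment> \<open>A common height above \<open>N\<close> for all active cubes; a sum, unlike a
    maximum, also makes sense when there are none.\<close>
  define J where "J = (\<Sum>Q\<in>Act. nat (fst (kz Q) - N))"
  have level: "\<exists>j\<le>J. fst (kz Q) = N + int j" if Q: "Q \<in> Act" for Q
  proof -
    obtain x y where "x \<in> Rd d" "y \<in> Rd d" "a Q x y \<noteq> 0" using Q unfolding Act_def by blast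
    then have "N + int r < fst (kz Q)" using fine[of "snd (kz Q)" x y "fst (kz Q)"] kz[OF Q] by simp
    moreover have "nat (fst (kz Q) - N) \<le> J"
      unfolding J_def using Q fin by (intro member_le_sum) (auto simp: Act_def)
    ultimately show ?thesis by (intro exI[of _ "nat (fst (kz Q) - N)"]) simp
  qed
  \<comment> \<open>The top cells over all active cubes. These can be several disjoint cells, hence
    the partition \<open>cm\<close> and a separate estimate in each.\<close>
  define Y where "Y = (\<Union>Q\<in>Act. cell J (corner (snd (kz Q))))"
  have Y: "finite Y" "Y \<subseteq> corners"
    using fin finite_cell cell_subset_corners[OF corner_in_corners] kz unfolding Y_def Act_def by blast+
  have cm: "class_map Y (cell J)"
    unfolding class_map_def using Y cell_eq[of _ J] self_in_cell by (auto simp: Y_def)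
  define s where "s p = (\<Sum>j\<le>J. \<Sum>q\<in>cell j p. ker j p q * mean f q)" for p
  \<comment> \<open>A nonzero kernel at \<open>p\<close> comes from an active cube of generation at
    most \<open>N + int J\<close> containing \<open>p\<close>, which would put \<open>p\<close> into
    \<open>Y\<close>.\<close>
  have s0: "s p = 0" if p: "p \<in> corners" "p \<notin> Y" for p
    unfolding s_def
  proof (intro sum.neutral ballI)
    fix j q assume j: "j \<in> {..J}" and q: "q \<in> cell j p"
    have "ker j p q = 0"
    proof (rule ccontr)
      let ?Q = "Cell (N + int j) p"
      assume "ker j p q \<noteq> 0"
      then have "a ?Q p q \<noteq> 0" by (auto simp: ker_def split: if_splits)
      moreover have Rd: "p \<in> Rd d" "q \<in> Rd d" using p q cell_subset_corners corners_Rd by blast+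
      moreover have "?Q \<in> grid_cubes" using Rd unfolding grid_cubes_def by blast
      ultimately have act: "?Q \<in> Act" unfolding Act_def by blast
      define z where "z = snd (kz ?Q)"
      have eq: "?Q = Cell (fst (kz ?Q)) z" using kz[OF act] by (simp add: z_def)
      have zRd: "z \<in> Rd d" using kz[OF act] by (simp add: z_def)
      have "N + int j = fst (kz ?Q)" by (rule Cell_level_inject[OF eq])
      then have "p \<in> Cell (N + int j) z" using eq self_in_Cell[OF Rd(1), of "N + int j"] by simp
      then have "p \<in> Cell (N + int J) (corner z)"
        unfolding Cell_corner_ge using Cell_mono[of "N + int j" "N + int J" z] j by auto
      then have "p \<in> cell J (corner z)" using p corner_in_corners[OF zRd] by (simp add: cell_def)
      then show False using p act unfolding Y_def z_def by blast
    qed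
    then show "ker j p q * mean f q = 0" by simp
  qed
  define g where "g = dyadic_shift d a grid_cubes f"
  have g: "g x = (if corner x \<in> Y then s (corner x) else 0)" if x: "x \<in> Rd d" for x
  proof -
    have "g x = (\<Sum>j\<in>{j. Cell (N + int j) (corner x) \<in> grid_cubes \<and> j \<le> J}.
                  \<Sum>q\<in>cell j (corner x). ker j (corner x) q * mean f q)"
      unfolding g_def
    proof (rule dyadic_shift_eq[OF subset_refl _ f_int x refl])
      fix Q x y assume Q: "Q \<in> grid_cubes" "x \<in> Rd d" "y \<in> Rd d" "a Q x y \<noteq> 0"
      then have "Q \<in> Act" unfolding Act_def by blast
      then show "\<exists>j\<le>J. \<exists>z\<in>Rd d. Q = Cell (N + int j) z"
        using level[of Q] kz[of Q] by metis
    qed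
    also have "{j. Cell (N + int j) (corner x) \<in> grid_cubes \<and> j \<le> J} = {..J}"
      using corner_Rd[of x] unfolding grid_cubes_def by blast
    finally have "g x = s (corner x)" by (simp add: s_def)
    then show ?thesis using s0[OF corner_in_corners[OF x]] by simp
  qed
  note g_step = step_function[where F = g and s = s and v = w, OF Y g w_int(1)]
  show gL2: "dyadic_shift d a grid_cubes f \<in> L2 d w"
    using g_step(1,2) by (simp add: L2_def g_def)
  define K where "K = 8 * (4 * 2 ^ d * B + 16 * r) * W"
  have K: "0 \<le> K" using B W1 by (simp add: K_def)
  have cls: "(\<Sum>p\<in>cell J p0. (norm (s p))\<^sup>2 * w' p) \<le> K\<^sup>2 * (\<Sum>p\<in>cell J p0. (norm (mean f p))\<^sup>2 / \<sigma>' p)" for p0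
    unfolding s_def K_def
    by (rule weighted_bound[OF shift_ker ker_0 B L2_transfer[OF B L2] pos'(2) pos'(1) A2 one])
  have "(\<Sum>p\<in>Y. (norm (s p))\<^sup>2 * w' p) \<le> K\<^sup>2 * (\<Sum>p\<in>Y. (norm (mean f p))\<^sup>2 / \<sigma>' p)"
    unfolding sum_classes[OF cm] sum_distrib_left
    by (rule sum_mono) (use cls in \<open>auto simp: sum_distrib_left\<close>)
  \<comment> \<open>Cauchy-Schwarz bounds each mean of \<open>f\<close> by the weighted integral
    times \<nu>, and dividing by \<open>\<sigma>'\<close> cancels \<nu>.\<close>
  also have "\<dots> \<le> K\<^sup>2 * (\<Sum>p\<in>Y. (LINT x:Cell N p|Leb d. (norm (f x))\<^sup>2 * w x) / vol)"
  proof (intro mult_left_mono sum_mono)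
    fix p assume p: "p \<in> Y"
    have "(norm (LINT x:Cell N p|Leb d. f x))\<^sup>2 \<le> (LINT x:Cell N p|Leb d. norm (f x))\<^sup>2"
    proof (intro power_mono)
      have "norm (LINT x:Cell N p|Leb d. f x) \<le> (LINT x|Leb d. norm (indicat_real (Cell N p) x *\<^sub>R f x))"
        unfolding set_lebesgue_integral_def by (rule integral_norm_bound)
      then show "norm (LINT x:Cell N p|Leb d. f x) \<le> (LINT x:Cell N p|Leb d. norm (f x))"
        by (simp add: set_lebesgue_integral_def)
    qed simp
    also have "\<dots> \<le> (LINT x:Cell N p|Leb d. (norm (f x))\<^sup>2 * w x) * \<nu> p"
      unfolding \<nu>_def by (rule weighted_Cauchy_Schwarz(2)[OF _ _ _ w_pos]) (auto intro: fw_int w_int)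
    finally have "(norm (LINT x:Cell N p|Leb d. f x))\<^sup>2 \<le> (LINT x:Cell N p|Leb d. (norm (f x))\<^sup>2 * w x) * \<nu> p" .
    moreover have "p \<in> corners" using p Y by blast
    ultimately show "(norm (mean f p))\<^sup>2 / \<sigma>' p \<le> (LINT x:Cell N p|Leb d. (norm (f x))\<^sup>2 * w x) / vol"
      using vol_pos pos[of p]
      by (simp add: mean_def \<sigma>'_def norm_divide power_divide field_simps power2_eq_square)
  qed simp
  also have "(\<Sum>p\<in>Y. (LINT x:Cell N p|Leb d. (norm (f x))\<^sup>2 * w x) / vol)
      = (LINT x:(\<Union>p\<in>Y. Cell N p)|Leb d. (norm (f x))\<^sup>2 * w x) / vol"
    using Y disjoint_Cells[OF Y(2)]
    by (subst set_integral_finite_Union) (auto simp: sum_divide_distrib intro: fw_int)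
  also have "\<dots> \<le> (LINT x|Leb d. (norm (f x))\<^sup>2 * w x) / vol"
  proof (intro divide_right_mono)
    have U: "(\<Union>p\<in>Y. Cell N p) \<in> sets (Leb d)" using Y by auto
    show "(LINT x:(\<Union>p\<in>Y. Cell N p)|Leb d. (norm (f x))\<^sup>2 * w x) \<le> (LINT x|Leb d. (norm (f x))\<^sup>2 * w x)"
      unfolding set_lebesgue_integral_def
      using fw_int[OF U, unfolded set_integrable_def] fw
      by (rule integral_mono_AE)
        (use w_pos in \<open>auto elim!: eventually_mono simp: indicator_def\<close>)
  qed (use vol_pos in simp)
  finally have main: "(\<Sum>p\<in>Y. (norm (s p))\<^sup>2 * w' p) \<le> K\<^sup>2 * ((LINT x|Leb d. (norm (f x))\<^sup>2 * w x) / vol)"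
    using K by (simp add: mult_left_mono)
  have "(LINT x|Leb d. (norm (g x))\<^sup>2 * w x) = (\<Sum>p\<in>Y. (norm (s p))\<^sup>2 * \<mu> p)"
    unfolding \<mu>_def by (rule g_step(3))
  also have "\<dots> = (\<Sum>p\<in>Y. (norm (s p))\<^sup>2 * w' p) * vol"
    unfolding sum_distrib_right using Y vol_pos by (intro sum.cong) (auto simp: w'_def)
  also have "\<dots> \<le> K\<^sup>2 * (LINT x|Leb d. (norm (f x))\<^sup>2 * w x)"
    using mult_right_mono[OF main, of vol] vol_pos by simp
  finally have "L2_norm d w g \<le> sqrt (K\<^sup>2 * (LINT x|Leb d. (norm (f x))\<^sup>2 * w x))"
    unfolding L2_norm_def by (rule real_sqrt_le_mono)
  also have "\<dots> = K * L2_norm d w f"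
    using K by (simp add: L2_norm_def real_sqrt_mult)
  finally show "L2_norm d w (dyadic_shift d a grid_cubes f) \<le> 8 * (4 * 2 ^ d * B + 16 * r) * W * L2_norm d w f"
    by (simp add: g_def K_def)
qed

end

section \<open>The absolute constant and the conclusion\<close>

text \<open>The term with \<open>B\<close> contributes 8 * 4 = 32 and the term with \<open>r\<close>
  contributes 8 * 16 = 128, together 160. The rest is 2^d \<le> 2^(3d/2), B \<le> B^2 + 1 and r
  \<le> (r + 1)^2.\<close>

lemma dimension_constant_le:
  fixes B V :: real
  assumes "0 \<le> B" "0 \<le> V"
  shows "8 * (4 * 2 ^ d * B + 16 * real r) * V
     \<le> 160 * 2 powr (3 * real d / 2) * (real r + 1)\<^sup>2 * (B\<^sup>2 + 1) * V"
proof -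
  have d: "(2::real) ^ d \<le> 2 powr (3 * real d / 2)"
    by (simp flip: powr_realpow)
  have d1: "(1::real) \<le> 2 powr (3 * real d / 2)"
    using one_le_power[of "2::real" d] d by linarith
  have B: "B \<le> B\<^sup>2 + 1" using zero_le_power2[of "B - 1"] assms(1) by (simp add: power2_eq_square algebra_simps)
  have R: "1 \<le> (real r + 1)\<^sup>2" "real r \<le> (real r + 1)\<^sup>2" by (auto simp: power2_eq_square algebra_simps)
  have B1: "1 \<le> B\<^sup>2 + 1" by simp
  have 1: "2 ^ d * 1 * B \<le> 2 powr (3 * real d / 2) * (real r + 1)\<^sup>2 * (B\<^sup>2 + 1)"
    by (intro mult_mono d R B) (use assms in auto)
  have 2: "1 * real r * 1 \<le> 2 powr (3 * real d / 2) * (real r + 1)\<^sup>2 * (B\<^sup>2 + 1)"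
    by (intro mult_mono d1 R B1) auto
  have "8 * (4 * 2 ^ d * B + 16 * real r) \<le> 160 * (2 powr (3 * real d / 2) * (real r + 1)\<^sup>2 * (B\<^sup>2 + 1))"
    using 1 2 by simp
  from mult_right_mono[OF this assms(2)] show ?thesis by (simp add: mult_ac)
qed

theorem theorem5p1:
  shows "\<exists>C::real. 0 < C \<and>
    (\<forall>(d::nat) D (m::nat) (n::nat) (r::nat) a (B2::real).
       1 \<le> d \<longrightarrow> dyadic_lattice d D \<longrightarrow>
       elementary_shift d D m n a \<or> elementary_generalized_shift d D m n a \<longrightarrow>
       r = max m n \<longrightarrow>
       (SUP A\<in>Pow D. op_norm d (dyadic_shift d a A)) = ereal B2 \<longrightarrow>
       (\<forall>w. A2_weight d w \<longrightarrow>
          (\<forall>f\<in>L2 d w.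
             dyadic_shift d a D f \<in> L2 d w \<and>
             L2_norm d w (dyadic_shift d a D f)
               \<le> C * 2 powr (3 * real d / 2) * (real r + 1)\<^sup>2 * (B2\<^sup>2 + 1)
                 * real_of_ereal (A2_char d w) * L2_norm d w f)))"
proof (intro exI[of _ 160] conjI allI impI ballI)
  fix d m n r :: nat and D a B2 w f
  assume d: "1 \<le> d" and D: "dyadic_lattice d D"
    and S: "elementary_shift d D m n a \<or> elementary_generalized_shift d D m n a"
    and r: "r = max m n" and B2: "(SUP A\<in>Pow D. op_norm d (dyadic_shift d a A)) = ereal B2"
    and w: "A2_weight d w" and f: "f \<in> L2 d w"
  obtain t where "grid d t" and D_eq: "D = grid.grid_cubes d t"
    using dyadic_lattice_grid[OF d D] .
  interpret grid d t by fact
  \<comment> \<open>A Haar function is a generalized one, so both cases are treated as generalized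
    shifts.\<close>
  have ker: "shift_kernel (generalized_haar d grid_cubes) d grid_cubes m n a"
    using S unfolding elementary_shift_def elementary_generalized_shift_def shift_kernel_def haar_def D_eq
    by fast
  define Act where "Act = {Q \<in> grid_cubes. \<exists>x\<in>Rd d. \<exists>y\<in>Rd d. a Q x y \<noteq> 0}"
  have fin: "finite Act" using ker by (simp add: shift_kernel_def Act_def)
  have "\<forall>Q\<in>Act. \<exists>k z. Q = Cell k z" unfolding Act_def grid_cubes_def by blast
  then obtain lev where lev: "\<And>Q. Q \<in> Act \<Longrightarrow> \<exists>z. Q = Cell (lev Q) z" by metis
  \<comment> \<open>More than \<open>r\<close> generations below every active cube, as
    \<open>fine\<close> demands; inserting 0 gives the minimum a meaning when no kernel is
    active.\<close>
  define N where "N = Min (insert 0 (lev ` Act)) - int r - 1"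
  interpret shift_grid d t N r a
  proof
    show "a (Cell k z) x y = 0" if "z \<in> Rd d" "x \<in> Rd d" "y \<in> Rd d" "x \<notin> Cell k z \<or> y \<notin> Cell k z" for z x y k
      using shift_kernel_props(1)[OF ker] that by blast
    show "norm (a (Cell k z) x y) \<le> 1 / (2 powi k) ^ d" if "z \<in> Rd d" "x \<in> Rd d" "y \<in> Rd d" for z x y k
      using shift_kernel_props(2)[OF ker that] by (simp add: measure_Cell)
    show "a (Cell k z) x' y' = a (Cell k z) x y"
      if "z \<in> Rd d" "x \<in> Rd d" "y \<in> Rd d" "x' \<in> Cell l x" "y' \<in> Cell l y" "l + int r < k" for z x y x' y' l k
      using shift_kernel_props(3)[OF ker that(1-5)] that(6) by (simp add: r)
    show "N + int r < k" if "z \<in> Rd d" "x \<in> Rd d" "y \<in> Rd d" "a (Cell k z) x y \<noteq> 0" for z x y k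
    proof -
      have "Cell k z \<in> Act" unfolding Act_def grid_cubes_def using that by blast
      then have "lev (Cell k z) = k" "lev (Cell k z) \<in> lev ` Act"
        using lev[of "Cell k z"] Cell_level_inject by (metis, blast)
      then have "Min (insert 0 (lev ` Act)) \<le> k" using fin by (intro Min_le) auto
      then show ?thesis by (simp add: N_def)
    qed
  qed
  define V where "V = real_of_ereal (A2_char d w)"
  have char: "ereal ((1 / measure (Leb d) (cube d c s) * (LINT x:cube d c s|Leb d. w x)) *
      (1 / measure (Leb d) (cube d c s) * (LINT x:cube d c s|Leb d. inverse (w x)))) \<le> A2_char d w" if "0 < s" for c s
    unfolding A2_char_def using that by (intro SUP_upper2[of "(c, s)"]) auto
  \<comment> \<open>The supremum is below infinity by assumption and at least its real value on one
    cube, hence a real number.\<close>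
  have V: "ereal V = A2_char d w"
    unfolding V_def using w char[of 1 undefined] by (intro ereal_real') (auto simp: A2_weight_def)
  have W: "(LINT y:Cell k x|Leb d. w y) * (LINT y:Cell k x|Leb d. inverse (w y)) \<le> V * ((2 powi k) ^ d)\<^sup>2" for k x
  proof -
    let ?M = "((2::real) powi k) ^ d"
    have "(1 / ?M * (LINT y:Cell k x|Leb d. w y)) * (1 / ?M * (LINT y:Cell k x|Leb d. inverse (w y))) \<le> V"
      using char[of "2 powi k" "\<lambda>i. 2 powi k * idx k x i + t k i"]
      unfolding V[symmetric] Cell_cube[symmetric] measure_Cell by simp
    then show ?thesis by (simp add: field_simps power2_eq_square)
  qed
  have w_pos: "AE x in Leb d. 0 < w x" using w by (simp add: A2_weight_def weight_def)
  \<comment> \<open>Any cube would do: the integrals of \<open>w\<close> and its inverse are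
    nonnegative, so the bound \<open>W\<close> forces \<open>0 \<le> V\<close>.\<close>
  then have "0 \<le> (LINT y:Cell 0 undefined|Leb d. w y) * (LINT y:Cell 0 undefined|Leb d. inverse (w y))"
    unfolding set_lebesgue_integral_def
    by (intro mult_nonneg_nonneg integral_nonneg_AE) (auto elim!: eventually_mono)
  then have V0: "0 \<le> V" using W[of 0 undefined] by simp
  have w': "weight d w" using w by (simp add: A2_weight_def)
  note B = op_norm_SUP[OF B2[unfolded D_eq]]
  note bound = weighted_L2_bound[OF B(1) B(2) fin[unfolded Act_def] w' W f]
  show "dyadic_shift d a D f \<in> L2 d w" unfolding D_eq by (rule bound(1))
  have "L2_norm d w (dyadic_shift d a D f) \<le> 8 * (4 * 2 ^ d * B2 + 16 * real r) * V * L2_norm d w f"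
    using bound(2) by (simp add: D_eq)
  also have "\<dots> \<le> 160 * 2 powr (3 * real d / 2) * (real r + 1)\<^sup>2 * (B2\<^sup>2 + 1) * V * L2_norm d w f"
    unfolding L2_norm_def using w_pos
    by (intro mult_right_mono[OF dimension_constant_le[OF B(1) V0]] real_sqrt_ge_zero integral_nonneg_AE)
      (auto elim!: eventually_mono)
  finally show "L2_norm d w (dyadic_shift d a D f)
               \<le> 160 * 2 powr (3 * real d / 2) * (real r + 1)\<^sup>2 * (B2\<^sup>2 + 1)
                 * real_of_ereal (A2_char d w) * L2_norm d w f"
    by (simp add: V_def)
qed simp

end
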